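(* Let $\{J_1,J_2,J_3\}$ be an almost para-hypercomplex structure on a smooth four-manifold $M$. Let $V^{+}$ and $V^{-}$ be the subbundles of $TM$ corresponding to the eigenvalues $+1$ and $-1$ of $J_2$, respectively. For either choice of the sign $\pm$, the manifold $M$ admits a metric $g$ compatible with $\{J_1,J_2,J_3\}$ if and only if the vector bundle $V^{\pm}$ is orientable.
   Context: An almost para-hypercomplex structure on a smooth $4$-manifold $M$ is a triple $\{J_1,J_2,J_3\}$ of smooth endomorphisms of $TM$ such that $J_1^2=-J_2^2=-J_3^2=-\mathrm{Id}$ and $J_1J_2=-J_2J_1=J_3$. A metric (i.e. a pseudo-Riemannian metric: a smooth non-degenerate symmetric $(0,2)$-tensor, not assumed positive definite) $g$ on $M$ is compatible with $\{J_1,J_2,J_3\}$ if $g(J_1X,J_1Y)=-g(J_2X,J_2Y)=-g(J_3X,J_3Y)=g(X,Y)$ for all tangent vectors $X,Y$ at any point of $M$. *)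

theory Defs
  imports "HOL-Analysis.Analysis" "HOL-Library.Function_Algebras"
begin

(* Tangent vectors will be encoded as functions from charts to the model space,
   with the pointwise vector space structure. *)

instantiation "fun" :: (type, real_vector) real_vector
begin

definition scaleR_fun :: "real \<Rightarrow> ('a \<Rightarrow> 'b) \<Rightarrow> 'a \<Rightarrow> 'b" where
  "scaleR_fun r f = (\<lambda>x. r *\<^sub>R f x)"

instance
  by standard (auto simp: scaleR_fun_def fun_eq_iff algebra_simps)

end


primrec C_k_on ::
  "nat \<Rightarrow> 'a::real_normed_vector set \<Rightarrow> ('a \<Rightarrow> 'b::real_normed_vector) \<Rightarrow> bool" where
  "C_k_on 0 S f \<longleftrightarrow> continuous_on S f"
| "C_k_on (Suc k) S f \<longleftrightarrow>
     (\<forall>x\<in>S. f differentiable (at x)) \<and> (\<forall>v. C_k_on k S (\<lambda>x. frechet_derivative f (at x) v))"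

(* Only meant for open S. *)
definition smooth_on :: "'a::real_normed_vector set \<Rightarrow> ('a \<Rightarrow> 'b::real_normed_vector) \<Rightarrow> bool" where
  "smooth_on S f \<longleftrightarrow> (\<forall>k. C_k_on k S f)"


(* A chart is a pair of its domain and its coordinate map; the values of the map
   outside the domain are irrelevant. *)
type_synonym ('a, 'e) chart = "'a set \<times> ('a \<Rightarrow> 'e)"

abbreviation chart_dom :: "('a, 'e) chart \<Rightarrow> 'a set" where
  "chart_dom c \<equiv> fst c"

abbreviation chart_map :: "('a, 'e) chart \<Rightarrow> 'a \<Rightarrow> 'e" where
  "chart_map c \<equiv> snd c"

abbreviation chart_inv :: "('a, 'e) chart \<Rightarrow> 'e \<Rightarrow> 'a" where
  "chart_inv c \<equiv> inv_into (chart_dom c) (chart_map c)"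

definition is_chart :: "('a::topological_space, 'e::euclidean_space) chart \<Rightarrow> bool" where
  "is_chart c \<longleftrightarrow> open (chart_dom c) \<and> open (chart_map c ` chart_dom c) \<and>
     homeomorphism (chart_dom c) (chart_map c ` chart_dom c) (chart_map c) (chart_inv c)"

abbreviation transition :: "('a, 'e) chart \<Rightarrow> ('a, 'e) chart \<Rightarrow> 'e \<Rightarrow> 'e" where
  "transition c d \<equiv> chart_map d \<circ> chart_inv c"

(* The atlas carries the smooth structure; it need not be maximal.  The manifold is the
   union of the chart domains, an open subset of the ambient type, which supplies the
   Hausdorff and second countability axioms. *)
definition smooth_atlas ::
  "('a::{t2_space,second_countable_topology}, 'e::euclidean_space) chart set \<Rightarrow> bool" where
  "smooth_atlas A \<longleftrightarrow> (\<forall>c\<in>A. is_chart c) \<and>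
     (\<forall>c\<in>A. \<forall>d\<in>A. smooth_on (chart_map c ` (chart_dom c \<inter> chart_dom d)) (transition c d))"

definition manifold_carrier :: "('a, 'e) chart set \<Rightarrow> 'a set" where
  "manifold_carrier A = (\<Union>c\<in>A. chart_dom c)"

(* A tangent vector at p assigns to every chart around p its coordinate vector, these being
   related by the derivatives of the transition maps.  The value 0 at all other charts is a
   normalisation, so that tangent vectors at p are determined by their coordinates. *)
definition tangent_space ::
  "('a, 'e::euclidean_space) chart set \<Rightarrow> 'a \<Rightarrow> (('a, 'e) chart \<Rightarrow> 'e) set" where
  "tangent_space A p = {X.
     (\<forall>c\<in>A. \<forall>d\<in>A. p \<in> chart_dom c \<inter> chart_dom d \<longrightarrow>
        X d = frechet_derivative (transition c d) (at (chart_map c p)) (X c)) \<and>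
     (\<forall>c. \<not> (c \<in> A \<and> p \<in> chart_dom c) \<longrightarrow> X c = 0)}"

(* The tangent vector at p with coordinate vector v in the chart c; for a basis vector v
   this is a coordinate vector field of c. *)
definition chart_vector ::
  "('a, 'e::euclidean_space) chart set \<Rightarrow> ('a, 'e) chart \<Rightarrow> 'e \<Rightarrow> 'a \<Rightarrow> ('a, 'e) chart \<Rightarrow> 'e" where
  "chart_vector A c v p =
     (\<lambda>d. if d \<in> A \<and> p \<in> chart_dom d
          then frechet_derivative (transition c d) (at (chart_map c p)) v else 0)"


type_synonym ('a, 'e) vector_field = "'a \<Rightarrow> ('a, 'e) chart \<Rightarrow> 'e"
type_synonym ('a, 'e) endo_field = "'a \<Rightarrow> (('a, 'e) chart \<Rightarrow> 'e) \<Rightarrow> ('a, 'e) chart \<Rightarrow> 'e"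
type_synonym ('a, 'e) form_field = "'a \<Rightarrow> (('a, 'e) chart \<Rightarrow> 'e) \<Rightarrow> (('a, 'e) chart \<Rightarrow> 'e) \<Rightarrow> real"

definition smooth_vector_field_on ::
  "('a, 'e::euclidean_space) chart set \<Rightarrow> 'a set \<Rightarrow> ('a, 'e) vector_field \<Rightarrow> bool" where
  "smooth_vector_field_on A U X \<longleftrightarrow> (\<forall>p\<in>U. X p \<in> tangent_space A p) \<and>
     (\<forall>c\<in>A. smooth_on (chart_map c ` (U \<inter> chart_dom c)) (\<lambda>y. X (chart_inv c y) c))"

definition smooth_endomorphism ::
  "('a, 'e::euclidean_space) chart set \<Rightarrow> ('a, 'e) endo_field \<Rightarrow> bool" where
  "smooth_endomorphism A J \<longleftrightarrow>
     (\<forall>p\<in>manifold_carrier A.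
        (\<forall>X\<in>tangent_space A p. J p X \<in> tangent_space A p) \<and>
        (\<forall>X\<in>tangent_space A p. \<forall>Y\<in>tangent_space A p. J p (X + Y) = J p X + J p Y) \<and>
        (\<forall>X\<in>tangent_space A p. \<forall>r. J p (r *\<^sub>R X) = r *\<^sub>R J p X)) \<and>
     (\<forall>c\<in>A. \<forall>u\<in>Basis. smooth_on (chart_map c ` chart_dom c)
        (\<lambda>y. J (chart_inv c y) (chart_vector A c u (chart_inv c y)) c))"

(* No definiteness is required. *)
definition pseudo_riemannian_metric ::
  "('a, 'e::euclidean_space) chart set \<Rightarrow> ('a, 'e) form_field \<Rightarrow> bool" where
  "pseudo_riemannian_metric A g \<longleftrightarrow>
     (\<forall>p\<in>manifold_carrier A.
        (\<forall>X\<in>tangent_space A p. \<forall>Y\<in>tangent_space A p. \<forall>Z\<in>tangent_space A p.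
           g p (X + Y) Z = g p X Z + g p Y Z) \<and>
        (\<forall>X\<in>tangent_space A p. \<forall>Y\<in>tangent_space A p. \<forall>r. g p (r *\<^sub>R X) Y = r * g p X Y) \<and>
        (\<forall>X\<in>tangent_space A p. \<forall>Y\<in>tangent_space A p. g p X Y = g p Y X) \<and>
        (\<forall>X\<in>tangent_space A p. (\<forall>Y\<in>tangent_space A p. g p X Y = 0) \<longrightarrow> X = 0)) \<and>
     (\<forall>c\<in>A. \<forall>u\<in>Basis. \<forall>v\<in>Basis. smooth_on (chart_map c ` chart_dom c)
        (\<lambda>y. g (chart_inv c y) (chart_vector A c u (chart_inv c y)) (chart_vector A c v (chart_inv c y))))"

definition almost_para_hypercomplex ::
  "('a, 'e::euclidean_space) chart set \<Rightarrow>
   ('a, 'e) endo_field \<Rightarrow> ('a, 'e) endo_field \<Rightarrow> ('a, 'e) endo_field \<Rightarrow> bool" where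
  "almost_para_hypercomplex A J1 J2 J3 \<longleftrightarrow>
     smooth_endomorphism A J1 \<and> smooth_endomorphism A J2 \<and> smooth_endomorphism A J3 \<and>
     (\<forall>p\<in>manifold_carrier A. \<forall>X\<in>tangent_space A p.
        J1 p (J1 p X) = - X \<and> - J2 p (J2 p X) = - X \<and> - J3 p (J3 p X) = - X \<and>
        J1 p (J2 p X) = - J2 p (J1 p X) \<and> J1 p (J2 p X) = J3 p X)"

definition compatible_metric ::
  "('a, 'e::euclidean_space) chart set \<Rightarrow>
   ('a, 'e) endo_field \<Rightarrow> ('a, 'e) endo_field \<Rightarrow> ('a, 'e) endo_field \<Rightarrow> ('a, 'e) form_field \<Rightarrow> bool" where
  "compatible_metric A J1 J2 J3 g \<longleftrightarrow>
     (\<forall>p\<in>manifold_carrier A. \<forall>X\<in>tangent_space A p. \<forall>Y\<in>tangent_space A p.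
        g p (J1 p X) (J1 p Y) = g p X Y \<and>
        - g p (J2 p X) (J2 p Y) = g p X Y \<and>
        - g p (J3 p X) (J3 p Y) = g p X Y)"

definition eigenbundle ::
  "('a, 'e::euclidean_space) chart set \<Rightarrow> ('a, 'e) endo_field \<Rightarrow> real \<Rightarrow> 'a \<Rightarrow> (('a, 'e) chart \<Rightarrow> 'e) set" where
  "eigenbundle A J s p = {X \<in> tangent_space A p. J p X = s *\<^sub>R X}"


definition ordered_bases :: "'v::real_vector set \<Rightarrow> ('k::finite \<Rightarrow> 'v) set" where
  "ordered_bases W = {b. inj b \<and> independent (range b) \<and> span (range b) = W}"

definition same_orientation :: "'v::real_vector set \<Rightarrow> (('k::finite \<Rightarrow> 'v) \<times> ('k \<Rightarrow> 'v)) set" where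
  "same_orientation W = {(b, b'). b \<in> ordered_bases W \<and> b' \<in> ordered_bases W \<and>
     (\<exists>P :: real ^ 'k ^ 'k. det P > 0 \<and> (\<forall>j. b' j = (\<Sum>i\<in>UNIV. P $ i $ j *\<^sub>R b i)))}"

(* An orientation of W is an equivalence class of ordered bases. *)
definition orientations :: "'v::real_vector set \<Rightarrow> ('k::finite \<Rightarrow> 'v) set set" where
  "orientations W = ordered_bases W // same_orientation W"

(* The type argument encodes the rank CARD('k) of the subbundle V of the tangent bundle,
   which is given by its fibres.  An orientation of V orients the fibres in such a way that
   every point has a neighbourhood with a positively oriented smooth frame; in particular
   V is then locally spanned by smooth frames. *)
definition orientable_subbundle ::
  "'k::finite itself \<Rightarrow> ('a::topological_space, 'e::euclidean_space) chart set \<Rightarrow>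
   ('a \<Rightarrow> (('a, 'e) chart \<Rightarrow> 'e) set) \<Rightarrow> bool" where
  "orientable_subbundle r A V \<longleftrightarrow>
     (\<exists>ori :: 'a \<Rightarrow> ('k \<Rightarrow> ('a, 'e) chart \<Rightarrow> 'e) set.
        (\<forall>p\<in>manifold_carrier A. ori p \<in> orientations (V p)) \<and>
        (\<forall>p\<in>manifold_carrier A. \<exists>U. \<exists>b :: 'a \<Rightarrow> 'k \<Rightarrow> ('a, 'e) chart \<Rightarrow> 'e.
           open U \<and> p \<in> U \<and> U \<subseteq> manifold_carrier A \<and>
           (\<forall>i. smooth_vector_field_on A U (\<lambda>q. b q i)) \<and>
           (\<forall>q\<in>U. b q \<in> ori q)))"

end

theory Submission
  imports Defs
begin

text \<open>
  Since \<open>J1\<close> anticommutes with \<open>J2\<close>, it exchanges the eigenbundles \<open>V\<^sup>+\<close> and \<open>V\<^sup>-\<close>, which therefore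
  have rank 2, and \<open>J2\<close>-compatibility makes both of them isotropic. So a compatible metric \<open>g\<close> is
  determined by \<open>w(X, Y) = g(X, J1 Y)\<close> on \<open>V\<close>, which is an alternating form; any alternating form on
  \<open>V\<close> arises, and \<open>g\<close> is non-degenerate iff \<open>w\<close> is nowhere zero. A nowhere vanishing \<open>w\<close> orients
  \<open>V\<close>. Conversely, a local frame \<open>b\<close> of \<open>V\<close> gives the local form
  \<open>w(X, Y) = det (X, Y, J1 b\<^sub>1, J1 b\<^sub>2) det (b\<^sub>1, b\<^sub>2, J1 b\<^sub>1, J1 b\<^sub>2)\<close>, positive on \<open>b\<close>. Positivity with
  respect to an orientation is a convex condition, so the local metrics can be glued by cut-off functions.
\<close>

section \<open>Calculus of smooth functions\<close>

text \<open>The alternating forms on a plane \<open>V p\<close> form a line, so a compatible metric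
  amounts to a nowhere zero section of a real line bundle; this is why orientability is the whole
  obstruction, for either sign. The difficulty in gluing is that a sum of non-degenerate indefinite
  forms may degenerate; positivity of \<open>w\<close> on oriented bases is what survives sums with
  non-negative weights. It describes a cone, so the weights need not add up to 1. The determinant
  formula stands in for the dual frame of \<open>b\<close>: it is polynomial in the coordinates, so
  no inverse matrix has to be shown smooth. Its second factor is the value of the first determinant
  on \<open>b\<close> itself. The sign of that value depends on the chart, and the product turns it
  into a square. Conversely, the form \<open>w\<close> of a metric is positive on exactly one class
  of bases of each fibre, and smooth frames in that class come from projecting constant coordinate
  fields to \<open>V\<close>.\<close>

lemma has_derivative_cong_open:
  assumes "open S" "x \<in> S" "\<And>y. y \<in> S \<Longrightarrow> f y = g y"
  shows "(f has_derivative D) (at x) \<longleftrightarrow> (g has_derivative D) (at x)"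
  using has_derivative_transform_within_open[of f D x UNIV S g]
    has_derivative_transform_within_open[of g D x UNIV S f] assms by metis

lemma frechet_derivative_cong_open:
  assumes "open S" "x \<in> S" "\<And>y. y \<in> S \<Longrightarrow> f y = g y"
  shows "frechet_derivative f (at x) = frechet_derivative g (at x)"
  unfolding frechet_derivative_def using has_derivative_cong_open[OF assms] by simp

lemma C_k_on_cong:
  assumes "open S" "\<And>x. x \<in> S \<Longrightarrow> f x = g x"
  shows "C_k_on k S f \<longleftrightarrow> C_k_on k S g"
  using assms(2)
proof (induction k arbitrary: f g)
  case 0
  then show ?case using continuous_on_cong[of S S f g] by simp
next
  case (Suc k)
  have fd: "frechet_derivative f (at x) = frechet_derivative g (at x)" if "x \<in> S" for x
    using frechet_derivative_cong_open[OF assms(1) that] Suc.prems by blast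
  have "f differentiable at x \<longleftrightarrow> g differentiable at x" if "x \<in> S" for x
    unfolding differentiable_def using has_derivative_cong_open[OF assms(1) that] Suc.prems by blast
  moreover have "C_k_on k S (\<lambda>x. frechet_derivative f (at x) v) \<longleftrightarrow>
      C_k_on k S (\<lambda>x. frechet_derivative g (at x) v)" for v
    by (rule Suc.IH) (simp add: fd)
  ultimately show ?case by simp
qed

text \<open>\<open>frechet_derivative\<close> is a choice operator, awkward to compute with.
  Uniqueness of the derivative lets an explicit family \<open>f'\<close> on the open set replace
  it.\<close>

lemma C_k_on_SucI:
  assumes "open S" "\<And>x. x \<in> S \<Longrightarrow> (f has_derivative f' x) (at x)"
    "\<And>v. C_k_on k S (\<lambda>x. f' x v)"
  shows "C_k_on (Suc k) S f"
proof -
  have "frechet_derivative f (at x) = f' x" if "x \<in> S" for x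
    using frechet_derivative_at[OF assms(2)[OF that]] by simp
  then have "C_k_on k S (\<lambda>x. frechet_derivative f (at x) v)" for v
    using C_k_on_cong[OF assms(1), of "\<lambda>x. frechet_derivative f (at x) v" "\<lambda>x. f' x v"] assms(3)
    by simp
  then show ?thesis
    using assms(2) by (auto simp: differentiable_def)
qed

lemma C_k_on_Suc_has_derivative:
  assumes "C_k_on (Suc k) S f" "x \<in> S"
  shows "(f has_derivative frechet_derivative f (at x)) (at x)"
  using assms frechet_derivative_works by auto

lemma C_k_on_SucD:
  assumes "C_k_on (Suc k) S f"
  shows "C_k_on k S f"
  using assms
proof (induction k arbitrary: f)
  case 0
  then show ?case
    by (auto intro!: continuous_at_imp_continuous_on differentiable_imp_continuous_within)
next
  case (Suc k)
  show ?case
    using Suc.prems Suc.IH unfolding C_k_on.simps(2)[of "Suc k"] C_k_on.simps(2)[of k S f] by blast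
qed

lemma C_k_on_subset:
  assumes "C_k_on k S f" "T \<subseteq> S"
  shows "C_k_on k T f"
  using assms(1)
proof (induction k arbitrary: f)
  case 0
  then show ?case using continuous_on_subset assms(2) by auto
next
  case (Suc k)
  then show ?case using assms(2) by auto
qed

text \<open>For functions given by different formulas on different open sets, such as a cut-off
  extended by zero.\<close>

lemma C_k_on_locally:
  assumes "open S" "\<And>x. x \<in> S \<Longrightarrow> \<exists>T. open T \<and> x \<in> T \<and> C_k_on k (S \<inter> T) f"
  shows "C_k_on k S f"
  using assms(2)
proof (induction k arbitrary: f)
  case 0
  have "continuous (at x) f" if "x \<in> S" for x
  proof -
    obtain T where "open T" "x \<in> T" "continuous_on (S \<inter> T) f"
      using 0[OF \<open>x \<in> S\<close>] unfolding C_k_on.simps by blast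
    then show ?thesis
      using assms(1) that continuous_on_eq_continuous_at[of "S \<inter> T" f] by auto
  qed
  then show ?case by (simp add: continuous_at_imp_continuous_on)
next
  case (Suc k)
  show ?case
    unfolding C_k_on.simps
  proof (intro conjI ballI allI)
    fix x assume "x \<in> S"
    then show "f differentiable at x" using Suc.prems[of x] by auto
  next
    fix v
    show "C_k_on k S (\<lambda>x. frechet_derivative f (at x) v)"
      by (rule Suc.IH) (use Suc.prems in fastforce)
  qed
qed

lemma C_k_on_const: "open S \<Longrightarrow> C_k_on k S (\<lambda>x. c)"
proof (induction k arbitrary: c)
  case (Suc k)
  show ?case
    by (rule C_k_on_SucI[where f' = "\<lambda>x v. 0"]) (use Suc in auto)
qed simp

lemma C_k_on_bounded_linear:
  assumes "open S" "bounded_linear h" "C_k_on k S f"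
  shows "C_k_on k S (\<lambda>x. h (f x))"
  using assms(3)
proof (induction k arbitrary: f)
  case 0
  then show ?case
    using assms(2) by (auto intro: bounded_linear.continuous_on)
next
  case (Suc k)
  show ?case
  proof (rule C_k_on_SucI[OF assms(1)])
    show "((\<lambda>x. h (f x)) has_derivative (\<lambda>v. h (frechet_derivative f (at x) v))) (at x)"
      if "x \<in> S" for x
      by (rule bounded_linear.has_derivative[OF assms(2)])
        (rule C_k_on_Suc_has_derivative[OF Suc.prems that])
    show "C_k_on k S (\<lambda>x. h (frechet_derivative f (at x) v))" for v
      using Suc.IH Suc.prems by auto
  qed
qed

lemma C_k_on_add:
  assumes "open S" "C_k_on k S f" "C_k_on k S g"
  shows "C_k_on k S (\<lambda>x. f x + g x)"
  using assms(2,3)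
proof (induction k arbitrary: f g)
  case 0
  then show ?case by (auto intro: continuous_intros)
next
  case (Suc k)
  show ?case
  proof (rule C_k_on_SucI[OF assms(1)])
    show "((\<lambda>x. f x + g x) has_derivative
        (\<lambda>v. frechet_derivative f (at x) v + frechet_derivative g (at x) v)) (at x)"
      if "x \<in> S" for x
      by (rule has_derivative_add; rule C_k_on_Suc_has_derivative[OF _ that]) (fact Suc.prems)+
    show "C_k_on k S (\<lambda>x. frechet_derivative f (at x) v + frechet_derivative g (at x) v)" for v
      using Suc.IH Suc.prems by auto
  qed
qed

lemma C_k_on_bounded_bilinear:
  assumes "open S" "bounded_bilinear pr" "C_k_on k S f" "C_k_on k S g"
  shows "C_k_on k S (\<lambda>x. pr (f x) (g x))"
  using assms(3,4)
proof (induction k arbitrary: f g)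
  case 0
  then show ?case by (auto intro: bounded_bilinear.continuous_on[OF assms(2)])
next
  case (Suc k)
  show ?case
  proof (rule C_k_on_SucI[OF assms(1)])
    show "((\<lambda>x. pr (f x) (g x)) has_derivative
        (\<lambda>v. pr (f x) (frechet_derivative g (at x) v) + pr (frechet_derivative f (at x) v) (g x))) (at x)"
      if "x \<in> S" for x
      by (rule bounded_bilinear.FDERIV[OF assms(2)]; rule C_k_on_Suc_has_derivative[OF _ that])
        (fact Suc.prems)+
    show "C_k_on k S (\<lambda>x. pr (f x) (frechet_derivative g (at x) v) +
        pr (frechet_derivative f (at x) v) (g x))" for v
      using Suc C_k_on_SucD[OF Suc.prems(1)] C_k_on_SucD[OF Suc.prems(2)]
      by (intro C_k_on_add[OF assms(1)] Suc.IH) auto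
  qed
qed

lemma C_k_on_sum:
  assumes "open S" "\<And>i. i \<in> I \<Longrightarrow> C_k_on k S (f i)"
  shows "C_k_on k S (\<lambda>x. \<Sum>i\<in>I. f i x)"
  using assms(2)
  by (induction I rule: infinite_finite_induct)
    (simp_all add: C_k_on_const[OF assms(1)] C_k_on_add[OF assms(1)])

text \<open>The chain rule yields \<open>?g' (f x) (?f' x v)\<close>, where the direction varies
  with \<open>x\<close>, so the induction hypothesis does not apply to it. Expanding
  \<open>?f' x v\<close> in the basis leaves derivatives of \<open>g\<close> in constant directions,
  composed with \<open>f\<close>, and smooth coefficients.\<close>

lemma C_k_on_compose:
  fixes f :: "'a::real_normed_vector \<Rightarrow> 'b::euclidean_space"
  assumes "open S" "C_k_on k S f" "C_k_on k T g" "\<And>x. x \<in> S \<Longrightarrow> f x \<in> T"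
  shows "C_k_on k S (\<lambda>x. g (f x))"
  using assms(2,3)
proof (induction k arbitrary: g)
  case 0
  then show ?case
    using continuous_on_compose2[of T g S f] assms(4) by auto
next
  case (Suc k)
  let ?f' = "\<lambda>x. frechet_derivative f (at x)" and ?g' = "\<lambda>y. frechet_derivative g (at y)"
  show ?case
  proof (rule C_k_on_SucI[OF assms(1)])
    fix x assume x: "x \<in> S"
    have df: "(f has_derivative ?f' x) (at x)"
      using C_k_on_Suc_has_derivative[OF Suc.prems(1) x] .
    have dg: "(g has_derivative ?g' (f x)) (at (f x))"
      using C_k_on_Suc_has_derivative[OF Suc.prems(2) assms(4)[OF x]] .
    have "?g' (f x) (?f' x v) = (\<Sum>b\<in>Basis. (?f' x v \<bullet> b) *\<^sub>R ?g' (f x) b)" for v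
    proof -
      interpret linear "?g' (f x)" using has_derivative_linear[OF dg] .
      have "?g' (f x) (?f' x v) = ?g' (f x) (\<Sum>b\<in>Basis. (?f' x v \<bullet> b) *\<^sub>R b)"
        by (simp add: euclidean_representation)
      then show ?thesis by (simp add: sum scaleR)
    qed
    then show "((\<lambda>x. g (f x)) has_derivative
        (\<lambda>v. \<Sum>b\<in>Basis. (?f' x v \<bullet> b) *\<^sub>R ?g' (f x) b)) (at x)"
      using has_derivative_compose[OF df dg] by simp
  next
    fix v
    show "C_k_on k S (\<lambda>x. \<Sum>b\<in>Basis. (?f' x v \<bullet> b) *\<^sub>R ?g' (f x) b)"
      using Suc C_k_on_SucD[OF Suc.prems(1)]
      by (intro C_k_on_sum assms(1) C_k_on_bounded_bilinear[OF _ bounded_bilinear_scaleR]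
        C_k_on_bounded_linear[OF _ bounded_linear_inner_left] Suc.IH) auto
  qed
qed

lemma smooth_on_cong:
  assumes "open S" "\<And>x. x \<in> S \<Longrightarrow> f x = g x"
  shows "smooth_on S f \<longleftrightarrow> smooth_on S g"
  unfolding smooth_on_def using C_k_on_cong[OF assms] by simp

lemma smooth_on_subset: "smooth_on S f \<Longrightarrow> T \<subseteq> S \<Longrightarrow> smooth_on T f"
  unfolding smooth_on_def by (auto intro: C_k_on_subset)

lemma smooth_on_locally:
  assumes "open S" "\<And>x. x \<in> S \<Longrightarrow> \<exists>T. open T \<and> x \<in> T \<and> smooth_on (S \<inter> T) f"
  shows "smooth_on S f"
  unfolding smooth_on_def
  by (intro allI C_k_on_locally assms(1)) (use assms(2) smooth_on_def in metis)

lemma smooth_on_const: "open S \<Longrightarrow> smooth_on S (\<lambda>x. c)"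
  unfolding smooth_on_def by (auto intro: C_k_on_const)

lemma smooth_on_bounded_linear:
  "open S \<Longrightarrow> bounded_linear h \<Longrightarrow> smooth_on S f \<Longrightarrow> smooth_on S (\<lambda>x. h (f x))"
  unfolding smooth_on_def by (auto intro: C_k_on_bounded_linear)

lemma smooth_on_add:
  "open S \<Longrightarrow> smooth_on S f \<Longrightarrow> smooth_on S g \<Longrightarrow> smooth_on S (\<lambda>x. f x + g x)"
  unfolding smooth_on_def by (auto intro: C_k_on_add)

lemma smooth_on_bounded_bilinear:
  "open S \<Longrightarrow> bounded_bilinear pr \<Longrightarrow> smooth_on S f \<Longrightarrow> smooth_on S g \<Longrightarrow>
    smooth_on S (\<lambda>x. pr (f x) (g x))"
  unfolding smooth_on_def by (auto intro: C_k_on_bounded_bilinear)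

lemma smooth_on_compose:
  fixes f :: "'a::real_normed_vector \<Rightarrow> 'b::euclidean_space"
  assumes "open S" "smooth_on S f" "smooth_on T g" "\<And>x. x \<in> S \<Longrightarrow> f x \<in> T"
  shows "smooth_on S (\<lambda>x. g (f x))"
  using assms unfolding smooth_on_def by (auto intro: C_k_on_compose)

lemma smooth_on_ident: "open S \<Longrightarrow> smooth_on S (\<lambda>x. x)"
  unfolding smooth_on_def
proof
  fix k assume "open S"
  show "C_k_on k S (\<lambda>x. x)"
  proof (cases k)
    case (Suc m)
    show ?thesis
      unfolding Suc
      by (rule C_k_on_SucI[where f' = "\<lambda>x v. v"]) (use \<open>open S\<close> C_k_on_const in auto)
  qed simp
qed

lemma smooth_on_frechet_derivative:
  "smooth_on S f \<Longrightarrow> smooth_on S (\<lambda>x. frechet_derivative f (at x) v)"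
  unfolding smooth_on_def by (metis C_k_on.simps(2))

lemma smooth_on_has_derivative:
  "smooth_on S f \<Longrightarrow> x \<in> S \<Longrightarrow> (f has_derivative frechet_derivative f (at x)) (at x)"
  unfolding smooth_on_def by (auto intro: C_k_on_Suc_has_derivative)

lemma smooth_on_continuous_on: "smooth_on S f \<Longrightarrow> continuous_on S f"
  unfolding smooth_on_def by (metis C_k_on.simps(1))

text \<open>\<open>flat_exp 0\<close> is the standard flat function \<open>exp (-1/t)\<close>. The
  powers of \<open>1/t\<close> make the family closed under differentiation up to linear
  combinations, so smoothness follows by induction over all \<open>k\<close> at once.\<close>

definition flat_exp :: "nat \<Rightarrow> real \<Rightarrow> real" where
  "flat_exp k t = (if t > 0 then inverse t ^ k * exp (- inverse t) else 0)"

lemma flat_exp_tendsto_0: "(flat_exp k \<longlongrightarrow> 0) (at 0)"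
proof -
  have "((\<lambda>x. x ^ k / exp x) \<longlongrightarrow> 0) (at_top :: real filter)"
    by (rule tendsto_power_div_exp_0)
  then have "((\<lambda>t. inverse t ^ k / exp (inverse t)) \<longlongrightarrow> 0) (at_right (0::real))"
    by (rule filterlim_compose) (rule filterlim_inverse_at_top_right)
  moreover have "eventually (\<lambda>t. inverse t ^ k / exp (inverse t) = flat_exp k t) (at_right 0)"
    unfolding eventually_at_filter by (auto simp: flat_exp_def exp_minus divide_inverse)
  ultimately have "(flat_exp k \<longlongrightarrow> 0) (at_right 0)"
    by (rule Lim_transform_eventually)
  moreover have "(flat_exp k \<longlongrightarrow> 0) (at_left 0)"
    by (rule tendsto_eventually) (auto simp: eventually_at_filter flat_exp_def)
  ultimately show ?thesis by (rule filterlim_split_at_real[rotated])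
qed

lemma has_field_derivative_flat_exp:
  "(flat_exp k has_field_derivative flat_exp (k + 2) t - real k * flat_exp (k + 1) t) (at t)"
proof (cases t "0::real" rule: linorder_cases)
  case less
  have "((\<lambda>t. 0) has_field_derivative 0) (at t)" by simp
  then have "(flat_exp k has_field_derivative 0) (at t)"
    by (rule DERIV_cong_ev[THEN iffD1, rotated -1])
      (use less eventually_nhds_in_open[of "{..<0}" t] in \<open>auto simp: flat_exp_def elim!: eventually_mono\<close>)
  then show ?thesis using less by (simp add: flat_exp_def)
next
  case equal
  \<comment> \<open>At 0 the difference quotient is again a member of the family, and all members
    tend to 0 there.\<close>
  have "eventually (\<lambda>h. flat_exp (k + 1) h = (flat_exp k (0 + h) - flat_exp k 0) / h) (at 0)"
    unfolding eventually_at_filter by (auto simp: flat_exp_def field_simps)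
  then have "((\<lambda>h. (flat_exp k (0 + h) - flat_exp k 0) / h) \<longlongrightarrow> 0) (at 0)"
    using Lim_transform_eventually[OF flat_exp_tendsto_0] by fast
  then show ?thesis unfolding equal DERIV_def by (simp add: flat_exp_def)
next
  case greater
  have "((\<lambda>t. inverse t ^ k * exp (- inverse t)) has_field_derivative
      flat_exp (k + 2) t - real k * flat_exp (k + 1) t) (at t)"
    using greater power_minus_mult[of k t]
    by (cases "k = 0")
      (auto intro!: derivative_eq_intros simp: flat_exp_def field_simps power2_eq_square)
  then show ?thesis
    by (rule DERIV_cong_ev[THEN iffD1, rotated -1])
      (use greater eventually_nhds_in_open[of "{0<..}" t] in \<open>auto simp: flat_exp_def elim!: eventually_mono\<close>)
qed

lemma smooth_on_flat_exp: "smooth_on UNIV (flat_exp k)"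
proof -
  have "C_k_on m UNIV (flat_exp k)" for m
  proof (induction m arbitrary: k)
    case 0
    then show ?case
      using DERIV_isCont[OF has_field_derivative_flat_exp]
      by (auto intro: continuous_at_imp_continuous_on)
  next
    case (Suc m)
    show ?case
    proof (rule C_k_on_SucI)
      show "(flat_exp k has_derivative
          (\<lambda>v. (flat_exp (k + 2) t + (- real k) * flat_exp (k + 1) t) * v)) (at t)" for t
        using has_field_derivative_flat_exp[of k t] by (simp add: has_field_derivative_def)
      show "C_k_on m UNIV (\<lambda>t. (flat_exp (k + 2) t + (- real k) * flat_exp (k + 1) t) * v)" for v
        by (intro C_k_on_bounded_linear[OF _ bounded_linear_mult_left] C_k_on_add
          C_k_on_bounded_linear[OF _ bounded_linear_mult_right] Suc.IH open_UNIV)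
    qed simp
  qed
  then show ?thesis unfolding smooth_on_def by blast
qed

lemma flat_exp_nonneg: "flat_exp k t \<ge> 0"
  by (simp add: flat_exp_def)

lemma flat_exp_pos_iff: "flat_exp k t > 0 \<longleftrightarrow> t > 0"
  by (simp add: flat_exp_def)

section \<open>Smooth functions and vector fields on manifolds\<close>

lemma sum_fun_apply: "(\<Sum>i\<in>I. f i) x = (\<Sum>i\<in>I. f i x)"
  by (induction I rule: infinite_finite_induct) auto

lemma scaleR_fun_apply: "(r *\<^sub>R f) x = r *\<^sub>R f x"
  by (simp add: scaleR_fun_def)

text \<open>The smoothness clauses for fields read each component only in its own chart. A function
  read in all charts can be localised and combined freely, and every such clause is reduced to this
  notion.\<close>

definition smooth_fun_on ::
  "('a, 'e::euclidean_space) chart set \<Rightarrow> 'a set \<Rightarrow> ('a \<Rightarrow> 'b::real_normed_vector) \<Rightarrow> bool" where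
  "smooth_fun_on A U f \<longleftrightarrow>
     (\<forall>c\<in>A. smooth_on (chart_map c ` (U \<inter> chart_dom c)) (\<lambda>y. f (chart_inv c y)))"

locale smooth_manifold =
  fixes A :: "('a::{t2_space,second_countable_topology}, 'e::euclidean_space) chart set"
  assumes smooth_atlas: "smooth_atlas A"
begin

abbreviation M :: "'a set" where
  "M \<equiv> manifold_carrier A"

abbreviation T :: "'a \<Rightarrow> (('a, 'e) chart \<Rightarrow> 'e) set" where
  "T \<equiv> tangent_space A"

abbreviation D :: "('a, 'e) chart \<Rightarrow> ('a, 'e) chart \<Rightarrow> 'a \<Rightarrow> 'e \<Rightarrow> 'e" where
  "D c d p \<equiv> frechet_derivative (transition c d) (at (chart_map c p))"

section \<open>Charts, transition derivatives and tangent spaces\<close>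

lemma chart_homeomorphism:
  "c \<in> A \<Longrightarrow> homeomorphism (chart_dom c) (chart_map c ` chart_dom c) (chart_map c) (chart_inv c)"
  using smooth_atlas unfolding smooth_atlas_def is_chart_def by blast

lemma open_chart_dom: "c \<in> A \<Longrightarrow> open (chart_dom c)"
  using smooth_atlas unfolding smooth_atlas_def is_chart_def by blast

lemma open_chart_image: "c \<in> A \<Longrightarrow> open (chart_map c ` chart_dom c)"
  using smooth_atlas unfolding smooth_atlas_def is_chart_def by blast

lemma chart_inv_map [simp]:
  "c \<in> A \<Longrightarrow> p \<in> chart_dom c \<Longrightarrow> chart_inv c (chart_map c p) = p"
  using chart_homeomorphism unfolding homeomorphism_def by blast

lemma chart_inv_in:
  "c \<in> A \<Longrightarrow> y \<in> chart_map c ` (U \<inter> chart_dom c) \<Longrightarrow> chart_inv c y \<in> U"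
  by auto

lemma open_coord_image:
  assumes "c \<in> A" "open U"
  shows "open (chart_map c ` (U \<inter> chart_dom c))"
proof -
  have "openin (top_of_set (chart_dom c)) (U \<inter> chart_dom c)"
    using assms(2) by (auto simp: openin_open)
  then have "openin (top_of_set (chart_map c ` chart_dom c)) (chart_map c ` (U \<inter> chart_dom c))"
    using homeomorphism_imp_open_map[OF chart_homeomorphism[OF assms(1)]] by blast
  then show ?thesis
    using openin_open_trans open_chart_image[OF assms(1)] by blast
qed

lemma open_chart_preimage:
  assumes "c \<in> A" "open W"
  shows "open {p \<in> chart_dom c. chart_map c p \<in> W}"
proof -
  have "continuous_on (chart_dom c) (chart_map c)"
    using chart_homeomorphism[OF assms(1)] unfolding homeomorphism_def by blast
  then have "open (chart_map c -` W \<inter> chart_dom c)"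
    using continuous_on_open_vimage[OF open_chart_dom[OF assms(1)]] assms(2) by blast
  moreover have "chart_map c -` W \<inter> chart_dom c = {p \<in> chart_dom c. chart_map c p \<in> W}"
    by auto
  ultimately show ?thesis by simp
qed

lemma open_carrier: "open M"
  unfolding manifold_carrier_def using open_chart_dom by blast

lemma carrierI: "c \<in> A \<Longrightarrow> p \<in> chart_dom c \<Longrightarrow> p \<in> M"
  unfolding manifold_carrier_def by blast

lemma carrierE:
  assumes "p \<in> M"
  obtains c where "c \<in> A" "p \<in> chart_dom c"
  using assms unfolding manifold_carrier_def by blast

lemma smooth_on_transition:
  "c \<in> A \<Longrightarrow> d \<in> A \<Longrightarrow> smooth_on (chart_map c ` (chart_dom d \<inter> chart_dom c)) (transition c d)"
  using smooth_atlas unfolding smooth_atlas_def by (metis Int_commute)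

lemma has_derivative_transition:
  assumes "c \<in> A" "d \<in> A" "p \<in> chart_dom c" "p \<in> chart_dom d"
  shows "(transition c d has_derivative D c d p) (at (chart_map c p))"
  by (rule smooth_on_has_derivative[OF smooth_on_transition]) (use assms in auto)

lemma linear_D:
  assumes "c \<in> A" "d \<in> A" "p \<in> chart_dom c" "p \<in> chart_dom d"
  shows "linear (D c d p)"
  using has_derivative_linear[OF has_derivative_transition[OF assms]] .

text \<open>The cocycle law: the chain rule, applied on the image of the triple overlap, which is
  open and on which the transition maps compose.\<close>

lemma D_D:
  assumes "c \<in> A" "d \<in> A" "e \<in> A" "p \<in> chart_dom c" "p \<in> chart_dom d" "p \<in> chart_dom e"
  shows "D d e p (D c d p v) = D c e p v"
proof -
  let ?S = "chart_map c ` ((chart_dom d \<inter> chart_dom e) \<inter> chart_dom c)"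
  have "transition c d (chart_map c p) = chart_map d p"
    using assms by simp
  then have "((\<lambda>y. transition d e (transition c d y)) has_derivative
      (\<lambda>v. D d e p (D c d p v))) (at (chart_map c p))"
    using has_derivative_compose[OF has_derivative_transition[of c d p]]
      has_derivative_transition[of d e p] assms by metis
  moreover have "open ?S"
    by (intro open_coord_image open_Int open_chart_dom assms)
  moreover have "transition d e (transition c d y) = transition c e y" if "y \<in> ?S" for y
    using that assms by auto
  ultimately have "(transition c e has_derivative (\<lambda>v. D d e p (D c d p v))) (at (chart_map c p))"
    using has_derivative_cong_open[of ?S "chart_map c p"
        "\<lambda>y. transition d e (transition c d y)" "transition c e"] assms by blast
  then show ?thesis using frechet_derivative_at by metis
qed

lemma D_same:
  assumes "c \<in> A" "p \<in> chart_dom c"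
  shows "D c c p v = v"
proof -
  have "transition c c y = y" if "y \<in> chart_map c ` chart_dom c" for y
    using that assms by auto
  then have "(transition c c has_derivative (\<lambda>v. v)) (at (chart_map c p))"
    using has_derivative_cong_open[of "chart_map c ` chart_dom c" "chart_map c p" "transition c c" "\<lambda>y. y"]
      open_chart_image assms by auto
  then show ?thesis using frechet_derivative_at by metis
qed

lemma tangentD:
  "X \<in> T p \<Longrightarrow> c \<in> A \<Longrightarrow> d \<in> A \<Longrightarrow> p \<in> chart_dom c \<Longrightarrow> p \<in> chart_dom d \<Longrightarrow> X d = D c d p (X c)"
  unfolding tangent_space_def by blast

lemma tangentD0: "X \<in> T p \<Longrightarrow> \<not> (c \<in> A \<and> p \<in> chart_dom c) \<Longrightarrow> X c = 0"
  unfolding tangent_space_def by blast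

lemma tangent_add:
  assumes "X \<in> T p" "Y \<in> T p"
  shows "X + Y \<in> T p"
  unfolding tangent_space_def
proof (intro CollectI conjI ballI impI allI)
  fix c d assume "c \<in> A" "d \<in> A" "p \<in> chart_dom c \<inter> chart_dom d"
  then show "(X + Y) d = D c d p ((X + Y) c)"
    using tangentD[OF assms(1), of c d] tangentD[OF assms(2), of c d] linear_add[OF linear_D] by simp
qed (simp add: tangentD0[OF assms(1)] tangentD0[OF assms(2)])

lemma tangent_scaleR:
  assumes "X \<in> T p"
  shows "r *\<^sub>R X \<in> T p"
  unfolding tangent_space_def
proof (intro CollectI conjI ballI impI allI)
  fix c d assume "c \<in> A" "d \<in> A" "p \<in> chart_dom c \<inter> chart_dom d"
  then show "(r *\<^sub>R X) d = D c d p ((r *\<^sub>R X) c)"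
    using tangentD[OF assms(1), of c d] linear_scale[OF linear_D] by (simp add: scaleR_fun_apply)
qed (simp add: tangentD0[OF assms] scaleR_fun_apply)

lemma chart_vector_apply:
  "d \<in> A \<Longrightarrow> p \<in> chart_dom d \<Longrightarrow> chart_vector A c v p d = D c d p v"
  by (simp add: chart_vector_def)

lemma chart_vector_same:
  "c \<in> A \<Longrightarrow> p \<in> chart_dom c \<Longrightarrow> chart_vector A c v p c = v"
  by (simp add: chart_vector_apply D_same)

lemma chart_vector_tangent:
  assumes "c \<in> A" "p \<in> chart_dom c"
  shows "chart_vector A c v p \<in> T p"
  unfolding tangent_space_def using assms
  by (auto simp: chart_vector_def D_D)

lemma tangent_zero: "0 \<in> T p"
  unfolding tangent_space_def using linear_0[OF linear_D] by auto

lemma subspace_tangent: "subspace (T p)"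
  by (simp add: subspace_def tangent_zero tangent_add tangent_scaleR)

text \<open>One coordinate vector fixes those in all charts around \<open>p\<close>; at the
  remaining charts both sides are 0 by the normalisation of tangent vectors.\<close>

lemma tangent_eq_chart_vector:
  assumes "X \<in> T p" "c \<in> A" "p \<in> chart_dom c"
  shows "X = chart_vector A c (X c) p"
proof
  fix d
  show "X d = chart_vector A c (X c) p d"
    using assms tangentD[of X p c d] tangentD0[of X p d] by (simp add: chart_vector_def)
qed

lemma tangent_eqI:
  "X \<in> T p \<Longrightarrow> Y \<in> T p \<Longrightarrow> c \<in> A \<Longrightarrow> p \<in> chart_dom c \<Longrightarrow> X c = Y c \<Longrightarrow> X = Y"
  using tangent_eq_chart_vector by metis

lemma linear_chart_vector:
  assumes "c \<in> A" "p \<in> chart_dom c"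
  shows "linear (\<lambda>v. chart_vector A c v p)"
  by (rule linearI; rule tangent_eqI[OF _ _ assms])
    (simp_all add: assms tangent_add tangent_scaleR chart_vector_tangent chart_vector_same scaleR_fun_apply)

lemma tangent_expansion:
  assumes "X \<in> T p" "c \<in> A" "p \<in> chart_dom c"
  shows "X = (\<Sum>u\<in>Basis. (X c \<bullet> u) *\<^sub>R chart_vector A c u p)"
proof -
  interpret linear "\<lambda>v. chart_vector A c v p"
    using linear_chart_vector assms by blast
  have "X = chart_vector A c (\<Sum>u\<in>Basis. (X c \<bullet> u) *\<^sub>R u) p"
    using tangent_eq_chart_vector[OF assms] by (simp add: euclidean_representation)
  then show ?thesis by (simp add: sum scaleR)
qed

section \<open>Smooth functions on open subsets\<close>

lemma smooth_fun_onD: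
  "smooth_fun_on A U f \<Longrightarrow> c \<in> A \<Longrightarrow>
    smooth_on (chart_map c ` (U \<inter> chart_dom c)) (\<lambda>y. f (chart_inv c y))"
  unfolding smooth_fun_on_def by blast

lemma smooth_fun_on_subset: "smooth_fun_on A U f \<Longrightarrow> W \<subseteq> U \<Longrightarrow> smooth_fun_on A W f"
  unfolding smooth_fun_on_def by (meson smooth_on_subset image_mono Int_mono order_refl)

lemma smooth_fun_on_cong:
  assumes "open U" "\<And>q. q \<in> U \<Longrightarrow> f q = g q"
  shows "smooth_fun_on A U f \<longleftrightarrow> smooth_fun_on A U g"
  unfolding smooth_fun_on_def
  by (intro ball_cong refl smooth_on_cong open_coord_image assms) (simp_all add: chart_inv_in)

lemma smooth_fun_on_locally:
  assumes "open U" "\<And>p. p \<in> U \<Longrightarrow> \<exists>W. open W \<and> p \<in> W \<and> smooth_fun_on A (U \<inter> W) f"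
  shows "smooth_fun_on A U f"
  unfolding smooth_fun_on_def
proof
  fix c assume c: "c \<in> A"
  show "smooth_on (chart_map c ` (U \<inter> chart_dom c)) (\<lambda>y. f (chart_inv c y))"
  proof (rule smooth_on_locally)
    fix y assume "y \<in> chart_map c ` (U \<inter> chart_dom c)"
    then obtain p where p: "p \<in> U" "p \<in> chart_dom c" "y = chart_map c p" by blast
    obtain W where W: "open W" "p \<in> W" "smooth_fun_on A (U \<inter> W) f"
      using assms(2) p(1) by blast
    \<comment> \<open>The image of an intersection contains the intersection of the images because
      the chart map is injective on its domain.\<close>
    have "chart_map c ` (U \<inter> chart_dom c) \<inter> chart_map c ` (W \<inter> chart_dom c)
        \<subseteq> chart_map c ` ((U \<inter> W) \<inter> chart_dom c)"
    proof
      fix z assume "z \<in> chart_map c ` (U \<inter> chart_dom c) \<inter> chart_map c ` (W \<inter> chart_dom c)"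
      then obtain q r where qr: "q \<in> U" "q \<in> chart_dom c" "z = chart_map c q"
          "r \<in> W" "r \<in> chart_dom c" "z = chart_map c r"
        by blast
      then have "q = r" using c by (metis chart_inv_map)
      then show "z \<in> chart_map c ` (U \<inter> W \<inter> chart_dom c)" using qr by blast
    qed
    then show "\<exists>V. open V \<and> y \<in> V \<and>
        smooth_on (chart_map c ` (U \<inter> chart_dom c) \<inter> V) (\<lambda>y. f (chart_inv c y))"
      using open_coord_image[OF c W(1)] smooth_on_subset[OF smooth_fun_onD[OF W(3) c]] p W(2)
      by (intro exI[of _ "chart_map c ` (W \<inter> chart_dom c)"]) simp
  qed (rule open_coord_image[OF c assms(1)])
qed

lemma smooth_fun_on_const: "open U \<Longrightarrow> smooth_fun_on A U (\<lambda>q. c)"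
  unfolding smooth_fun_on_def using smooth_on_const open_coord_image by blast

lemma smooth_fun_on_add:
  "open U \<Longrightarrow> smooth_fun_on A U f \<Longrightarrow> smooth_fun_on A U g \<Longrightarrow> smooth_fun_on A U (\<lambda>q. f q + g q)"
  unfolding smooth_fun_on_def by (intro ballI smooth_on_add open_coord_image) auto

lemma smooth_fun_on_bounded_bilinear:
  "bounded_bilinear pr \<Longrightarrow> open U \<Longrightarrow> smooth_fun_on A U f \<Longrightarrow> smooth_fun_on A U g \<Longrightarrow>
    smooth_fun_on A U (\<lambda>q. pr (f q) (g q))"
  unfolding smooth_fun_on_def
  by (intro ballI, rule smooth_on_bounded_bilinear[of _ pr]) (simp_all add: open_coord_image)

lemmas smooth_fun_on_mult = smooth_fun_on_bounded_bilinear[OF bounded_bilinear_mult]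
lemmas smooth_fun_on_scaleR = smooth_fun_on_bounded_bilinear[OF bounded_bilinear_scaleR]

lemma smooth_fun_on_bounded_linear:
  "bounded_linear h \<Longrightarrow> open U \<Longrightarrow> smooth_fun_on A U f \<Longrightarrow> smooth_fun_on A U (\<lambda>q. h (f q))"
  unfolding smooth_fun_on_def
  by (intro ballI, rule smooth_on_bounded_linear[of _ h]) (simp_all add: open_coord_image)

lemmas smooth_fun_on_inner = smooth_fun_on_bounded_linear[OF bounded_linear_inner_left]

lemma smooth_fun_on_sum:
  "open U \<Longrightarrow> (\<And>i. i \<in> I \<Longrightarrow> smooth_fun_on A U (f i)) \<Longrightarrow> smooth_fun_on A U (\<lambda>q. \<Sum>i\<in>I. f i q)"
  by (induction I rule: infinite_finite_induct) (simp_all add: smooth_fun_on_const smooth_fun_on_add)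

lemma smooth_fun_on_prod:
  fixes f :: "'i \<Rightarrow> 'a \<Rightarrow> real"
  shows "open U \<Longrightarrow> (\<And>i. i \<in> I \<Longrightarrow> smooth_fun_on A U (f i)) \<Longrightarrow> smooth_fun_on A U (\<lambda>q. \<Prod>i\<in>I. f i q)"
  by (induction I rule: infinite_finite_induct) (simp_all add: smooth_fun_on_const smooth_fun_on_mult)

lemma smooth_fun_on_compose:
  fixes f :: "'a \<Rightarrow> 'b::euclidean_space"
  shows "open U \<Longrightarrow> smooth_on UNIV h \<Longrightarrow> smooth_fun_on A U f \<Longrightarrow> smooth_fun_on A U (\<lambda>q. h (f q))"
  unfolding smooth_fun_on_def by (auto intro: smooth_on_compose open_coord_image)

text \<open>In any other chart the function is its expression in \<open>c\<close> after a transition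
  map, so one chart that contains \<open>U\<close> decides smoothness.\<close>

lemma smooth_fun_on_single_chart:
  assumes "c \<in> A" "open U" "U \<subseteq> chart_dom c"
    "smooth_on (chart_map c ` (U \<inter> chart_dom c)) (\<lambda>y. f (chart_inv c y))"
  shows "smooth_fun_on A U f"
  unfolding smooth_fun_on_def
proof
  fix d assume d: "d \<in> A"
  let ?S = "chart_map d ` (U \<inter> chart_dom d)"
  have S: "open ?S" using open_coord_image d assms(2) .
  have "smooth_on ?S (transition d c)"
    by (rule smooth_on_subset[OF smooth_on_transition[OF d assms(1)] image_mono]) (use assms(3) in auto)
  then have "smooth_on ?S (\<lambda>y. f (chart_inv c (transition d c y)))"
    using smooth_on_compose[OF S _ assms(4), of "transition d c"] assms(3) d by fastforce
  moreover have "f (chart_inv c (transition d c y)) = f (chart_inv d y)" if "y \<in> ?S" for y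
    using that assms d by auto
  ultimately show "smooth_on ?S (\<lambda>y. f (chart_inv d y))"
    using smooth_on_cong[OF S, of "\<lambda>y. f (chart_inv c (transition d c y))" "\<lambda>y. f (chart_inv d y)"]
    by blast
qed

text \<open>Continuity is at hand only in coordinates, so near each point the set is pulled back
  from a chart. This provides the regions where a frame stays positive and the sets of the cover
  used for gluing.\<close>

lemma open_superlevel:
  fixes f :: "'a \<Rightarrow> real"
  assumes "open U" "U \<subseteq> M" "smooth_fun_on A U f"
  shows "open {q \<in> U. f q > a}"
proof (subst open_subopen, clarify)
  fix p assume p: "p \<in> U" "f p > a"
  then obtain c where c: "c \<in> A" "p \<in> chart_dom c" using assms(2) carrierE by blast
  let ?S = "chart_map c ` (U \<inter> chart_dom c)"
  let ?F = "\<lambda>y. f (chart_inv c y)"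
  have "open ({y \<in> ?S. ?F y > a})"
  proof -
    have "continuous_on ?S ?F"
      using smooth_on_continuous_on smooth_fun_onD[OF assms(3) c(1)] by blast
    then have "open (?F -` {a<..} \<inter> ?S)"
      using continuous_on_open_vimage[OF open_coord_image[OF c(1) assms(1)]] open_greaterThan by blast
    then show ?thesis by (simp add: vimage_def Int_def conj_commute)
  qed
  then have "open {q \<in> chart_dom c. chart_map c q \<in> {y \<in> ?S. ?F y > a}}"
    using open_chart_preimage c by blast
  moreover have "{q \<in> chart_dom c. chart_map c q \<in> {y \<in> ?S. ?F y > a}} \<subseteq> {q \<in> U. f q > a}"
    using c(1) by (auto dest: arg_cong[of _ _ "chart_inv c"])
  ultimately show "\<exists>W. open W \<and> p \<in> W \<and> W \<subseteq> {q \<in> U. f q > a}"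
    using p c by (intro exI[of _ "{q \<in> chart_dom c. chart_map c q \<in> {y \<in> ?S. ?F y > a}}"]) auto
qed

section \<open>Smooth vector fields and endomorphisms\<close>

lemma smooth_vector_field_onI:
  assumes "open U" "\<And>q. q \<in> U \<Longrightarrow> X q \<in> T q"
    "\<And>c. c \<in> A \<Longrightarrow> smooth_fun_on A (U \<inter> chart_dom c) (\<lambda>q. X q c)"
  shows "smooth_vector_field_on A U X"
  unfolding smooth_vector_field_on_def
proof (intro conjI ballI assms(2))
  fix c assume "c \<in> A"
  then show "smooth_on (chart_map c ` (U \<inter> chart_dom c)) (\<lambda>y. X (chart_inv c y) c)"
    using smooth_fun_onD[OF assms(3), of c c] by (simp add: Int_assoc)
qed

lemma smooth_vector_field_on_tangent: "smooth_vector_field_on A U X \<Longrightarrow> q \<in> U \<Longrightarrow> X q \<in> T q"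
  unfolding smooth_vector_field_on_def by blast

text \<open>Converse of the introduction rule: vector fields are handled through their components,
  which are functions smooth in every chart.\<close>

lemma smooth_vector_field_on_coord:
  assumes "open U" "smooth_vector_field_on A U X" "c \<in> A"
  shows "smooth_fun_on A (U \<inter> chart_dom c) (\<lambda>q. X q c)"
proof (rule smooth_fun_on_single_chart[OF assms(3)])
  show "open (U \<inter> chart_dom c)"
    using assms open_chart_dom by blast
  show "smooth_on (chart_map c ` (U \<inter> chart_dom c \<inter> chart_dom c)) (\<lambda>y. X (chart_inv c y) c)"
    using assms by (simp add: smooth_vector_field_on_def Int_assoc)
qed simp

lemma smooth_vector_field_on_cong:
  assumes "open U" "\<And>q. q \<in> U \<Longrightarrow> X q = Y q"
  shows "smooth_vector_field_on A U X \<longleftrightarrow> smooth_vector_field_on A U Y"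
proof -
  have "smooth_on (chart_map c ` (U \<inter> chart_dom c)) (\<lambda>y. X (chart_inv c y) c) \<longleftrightarrow>
      smooth_on (chart_map c ` (U \<inter> chart_dom c)) (\<lambda>y. Y (chart_inv c y) c)" if "c \<in> A" for c
    by (rule smooth_on_cong[OF open_coord_image[OF that assms(1)]]) (simp add: assms(2) chart_inv_in that)
  then show ?thesis
    unfolding smooth_vector_field_on_def using assms(2) by simp
qed

lemma smooth_vector_field_on_subset:
  "smooth_vector_field_on A U X \<Longrightarrow> W \<subseteq> U \<Longrightarrow> smooth_vector_field_on A W X"
  unfolding smooth_vector_field_on_def by (meson smooth_on_subset image_mono Int_mono order_refl subsetD)

lemma smooth_vector_field_on_add:
  assumes "open U" "smooth_vector_field_on A U X" "smooth_vector_field_on A U Y"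
  shows "smooth_vector_field_on A U (\<lambda>q. X q + Y q)"
proof (rule smooth_vector_field_onI[OF assms(1)])
  show "X q + Y q \<in> T q" if "q \<in> U" for q
    using smooth_vector_field_on_tangent[OF _ that] assms tangent_add by blast
  show "smooth_fun_on A (U \<inter> chart_dom c) (\<lambda>q. (X q + Y q) c)" if c: "c \<in> A" for c
    unfolding plus_fun_apply
    using smooth_vector_field_on_coord[OF assms(1) _ c] assms
    by (intro smooth_fun_on_add open_Int open_chart_dom c)
qed

lemma smooth_vector_field_on_scaleR:
  assumes "open U" "smooth_vector_field_on A U X"
  shows "smooth_vector_field_on A U (\<lambda>q. r *\<^sub>R X q)"
proof (rule smooth_vector_field_onI[OF assms(1)])
  show "r *\<^sub>R X q \<in> T q" if "q \<in> U" for q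
    using smooth_vector_field_on_tangent[OF assms(2) that] tangent_scaleR by blast
  show "smooth_fun_on A (U \<inter> chart_dom c) (\<lambda>q. (r *\<^sub>R X q) c)" if c: "c \<in> A" for c
    unfolding scaleR_fun_apply
    by (intro smooth_fun_on_scaleR smooth_fun_on_const smooth_vector_field_on_coord open_Int
      open_chart_dom c assms)
qed

text \<open>In the chart \<open>d\<close> the component is a directional derivative of
  \<open>transition c d\<close>, taken at the point \<open>transition d c y\<close>: a composition
  of two smooth maps.\<close>

lemma smooth_vector_field_on_chart_vector:
  assumes c: "c \<in> A"
  shows "smooth_vector_field_on A (chart_dom c) (chart_vector A c v)"
  unfolding smooth_vector_field_on_def
proof (intro conjI ballI)
  fix d assume d: "d \<in> A"
  let ?S = "chart_map d ` (chart_dom c \<inter> chart_dom d)"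
  have S: "open ?S" using open_coord_image d open_chart_dom c by blast
  have "smooth_on ?S (\<lambda>y. frechet_derivative (transition c d) (at (transition d c y)) v)"
    by (rule smooth_on_compose[OF S smooth_on_transition[OF d c]
      smooth_on_frechet_derivative[OF smooth_on_transition[OF c d]]]) (use c d in auto)
  then show "smooth_on ?S (\<lambda>y. chart_vector A c v (chart_inv d y) d)"
    by (rule smooth_on_cong[OF S, THEN iffD1, rotated])
      (use c d in \<open>auto simp: chart_vector_apply\<close>)
qed (use chart_vector_tangent c in blast)

lemma endomorphism_sum:
  assumes "smooth_endomorphism A J" "p \<in> M" "finite I" "\<And>i. i \<in> I \<Longrightarrow> X i \<in> T p"
  shows "J p (\<Sum>i\<in>I. r i *\<^sub>R X i) = (\<Sum>i\<in>I. r i *\<^sub>R J p (X i))"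
  using assms(3,4)
proof (induction I)
  case empty
  have "J p (0 *\<^sub>R 0) = 0 *\<^sub>R J p 0"
    using assms(1,2) tangent_zero unfolding smooth_endomorphism_def by blast
  then show ?case unfolding sum.empty scaleR_zero_left .
next
  case (insert i I)
  have "(\<Sum>i\<in>I. r i *\<^sub>R X i) \<in> T p"
    using insert.prems by (intro subspace_sum subspace_tangent tangent_scaleR) auto
  then have step: "J p (r i *\<^sub>R X i + (\<Sum>i\<in>I. r i *\<^sub>R X i)) = r i *\<^sub>R J p (X i) + J p (\<Sum>i\<in>I. r i *\<^sub>R X i)"
    using assms(1,2) insert.prems tangent_scaleR unfolding smooth_endomorphism_def by simp
  have "J p (\<Sum>i\<in>I. r i *\<^sub>R X i) = (\<Sum>i\<in>I. r i *\<^sub>R J p (X i))"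
    using insert.IH insert.prems by blast
  then show ?case
    unfolding sum.insert[OF insert.hyps] step by (rule arg_cong)
qed

text \<open>Smoothness of \<open>J\<close> is known on coordinate fields only. Expanding
  \<open>X\<close> in the coordinate fields of \<open>c\<close> and using linearity leaves a finite
  sum of smooth coefficients times known smooth components.\<close>

lemma smooth_vector_field_on_endomorphism:
  assumes J: "smooth_endomorphism A J" and "open U" "U \<subseteq> M" and X: "smooth_vector_field_on A U X"
  shows "smooth_vector_field_on A U (\<lambda>q. J q (X q))"
proof (rule smooth_vector_field_onI[OF assms(2)])
  fix q assume "q \<in> U"
  then show "J q (X q) \<in> T q"
    using assms smooth_vector_field_on_tangent unfolding smooth_endomorphism_def by blast
next
  fix c assume c: "c \<in> A"
  let ?U = "U \<inter> chart_dom c"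
  have U: "open ?U" using assms(2) c open_chart_dom by blast
  have "smooth_fun_on A (chart_dom c) (\<lambda>q. J q (chart_vector A c u q) c)" if "u \<in> Basis" for u
    by (rule smooth_fun_on_single_chart[OF c])
      (use J that c open_chart_dom in \<open>auto simp: smooth_endomorphism_def\<close>)
  then have "smooth_fun_on A ?U (\<lambda>q. J q (chart_vector A c u q) c)" if "u \<in> Basis" for u
    using that smooth_fun_on_subset by blast
  then have "smooth_fun_on A ?U (\<lambda>q. \<Sum>u\<in>Basis. (X q c \<bullet> u) *\<^sub>R J q (chart_vector A c u q) c)"
    by (intro smooth_fun_on_sum[OF U] smooth_fun_on_scaleR[OF U smooth_fun_on_inner[OF U
      smooth_vector_field_on_coord[OF assms(2) X c]]])
  moreover have "(\<Sum>u\<in>Basis. (X q c \<bullet> u) *\<^sub>R J q (chart_vector A c u q) c) = J q (X q) c"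
    if q: "q \<in> ?U" for q
  proof -
    have "X q = (\<Sum>u\<in>Basis. (X q c \<bullet> u) *\<^sub>R chart_vector A c u q)"
      using tangent_expansion smooth_vector_field_on_tangent[OF X] c q by blast
    then have "J q (X q) = J q (\<Sum>u\<in>Basis. (X q c \<bullet> u) *\<^sub>R chart_vector A c u q)"
      by (rule arg_cong)
    also have "\<dots> = (\<Sum>u\<in>Basis. (X q c \<bullet> u) *\<^sub>R J q (chart_vector A c u q))"
      using q c assms(3) chart_vector_tangent by (intro endomorphism_sum J) auto
    finally show ?thesis by (simp add: sum_fun_apply scaleR_fun_apply)
  qed
  ultimately show "smooth_fun_on A ?U (\<lambda>q. J q (X q) c)"
    by (rule smooth_fun_on_cong[OF U, THEN iffD1, rotated])
qed

text \<open>The bound \<open>u p > 1\<close> puts \<open>p\<close> into the set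
  \<open>u > 1\<close>, by which the gluing covers the manifold. The closed set \<open>K\<close>
  inside \<open>U\<close> allows products with \<open>u\<close> to be extended by zero.\<close>

lemma smooth_bump:
  assumes "open U" "p \<in> U" "p \<in> M"
  shows "\<exists>(u :: 'a \<Rightarrow> real) K. smooth_fun_on A M u \<and> (\<forall>q. u q \<ge> 0) \<and> u p > 1 \<and>
    closed K \<and> K \<subseteq> U \<and> (\<forall>q. q \<notin> K \<longrightarrow> u q = 0)"
proof -
  obtain c where c: "c \<in> A" "p \<in> chart_dom c" using assms(3) carrierE by blast
  let ?S = "chart_map c ` (U \<inter> chart_dom c)" and ?y = "chart_map c p"
  obtain e where e: "e > 0" "cball ?y e \<subseteq> ?S"
    using open_contains_cball open_coord_image[OF c(1) assms(1)] assms(2) c(2) by blast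
  \<comment> \<open>Compact as the continuous image of a closed ball, hence closed in the Hausdorff
    space.\<close>
  define K where "K = chart_inv c ` cball ?y e"
  have KU: "K \<subseteq> U \<inter> chart_dom c"
    unfolding K_def using e(2) c(1) by fastforce
  have "continuous_on (chart_map c ` chart_dom c) (chart_inv c)"
    using chart_homeomorphism[OF c(1)] unfolding homeomorphism_def by blast
  then have "continuous_on (cball ?y e) (chart_inv c)"
    by (rule continuous_on_subset) (use e(2) in blast)
  then have K: "closed K"
    unfolding K_def using compact_continuous_image compact_cball compact_imp_closed by blast
  \<comment> \<open>The argument of \<open>flat_exp 0\<close> is positive exactly inside the ball of
    radius \<open>e\<close>. The constant factor normalises the value at the centre to 2.\<close>
  define h where "h y = 2 / flat_exp 0 (e\<^sup>2) * flat_exp 0 (e\<^sup>2 + - ((y - ?y) \<bullet> (y - ?y)))" for y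
  have fe: "flat_exp 0 (e\<^sup>2) > 0" using e(1) by (simp add: flat_exp_pos_iff)
  have h: "smooth_on UNIV h"
  proof -
    have *: "smooth_on UNIV (\<lambda>y. y - ?y)"
      using smooth_on_add[OF open_UNIV smooth_on_ident[OF open_UNIV] smooth_on_const[OF open_UNIV], of "- ?y"]
      by simp
    have "smooth_on UNIV (\<lambda>y. e\<^sup>2 + - ((y - ?y) \<bullet> (y - ?y)))"
      by (intro smooth_on_add smooth_on_const open_UNIV smooth_on_bounded_linear[OF _ bounded_linear_minus[OF bounded_linear_ident]]
        smooth_on_bounded_bilinear[OF _ bounded_bilinear_inner] *)
    then have "smooth_on UNIV (\<lambda>y. flat_exp 0 (e\<^sup>2 + - ((y - ?y) \<bullet> (y - ?y))))"
      using smooth_on_compose[OF open_UNIV _ smooth_on_flat_exp] by blast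
    then show ?thesis unfolding h_def
      by (intro smooth_on_bounded_linear[OF _ bounded_linear_mult_right] open_UNIV)
  qed
  define u where "u q = (if q \<in> chart_dom c then h (chart_map c q) else 0)" for q
  have u0: "u q = 0" if "q \<notin> K" for q
  proof (cases "q \<in> chart_dom c")
    case True
    then have "chart_map c q \<notin> cball ?y e"
      using that c(1) unfolding K_def by (metis chart_inv_map imageI)
    then have "e < norm (chart_map c q - ?y)"
      by (simp add: dist_norm norm_minus_commute)
    then have "e\<^sup>2 \<le> (norm (chart_map c q - ?y))\<^sup>2"
      using e(1) by (intro power_mono) auto
    then show ?thesis
      using True by (simp add: u_def h_def flat_exp_def power2_norm_eq_inner)
  qed (simp add: u_def)
  \<comment> \<open>The chart domain and the complement of \<open>K\<close> are open and cover
    \<open>M\<close>; \<open>u\<close> is \<open>h\<close> in coordinates on the first and 0 on the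
    second.\<close>
  have "smooth_fun_on A M u"
  proof (rule smooth_fun_on_locally[OF open_carrier])
    fix q assume "q \<in> M"
    show "\<exists>W. open W \<and> q \<in> W \<and> smooth_fun_on A (M \<inter> W) u"
    proof (cases "q \<in> K")
      case True
      have "smooth_on (chart_map c ` (chart_dom c \<inter> chart_dom c)) (\<lambda>y. u (chart_inv c y))"
        by (rule smooth_on_cong[OF _ , THEN iffD2, OF _ _ smooth_on_subset[OF h]])
          (use c open_chart_image in \<open>auto simp: u_def\<close>)
      then have "smooth_fun_on A (chart_dom c) u"
        using smooth_fun_on_single_chart c open_chart_dom by blast
      then show ?thesis
        using True KU open_chart_dom[OF c(1)] smooth_fun_on_subset[of "chart_dom c" u "M \<inter> chart_dom c"]
        by blast
    next
      case False
      have "smooth_fun_on A (M \<inter> - K) u"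
        using smooth_fun_on_cong[of "M \<inter> - K" u "\<lambda>_. 0"] smooth_fun_on_const[of "M \<inter> - K" 0] u0
          open_carrier K by (simp add: open_Int open_Compl)
      then show ?thesis
        using False K by (intro exI[of _ "- K"]) auto
    qed
  qed
  moreover have "u q \<ge> 0" for q
    using flat_exp_nonneg fe by (simp add: u_def h_def)
  moreover have "u p > 1"
    using fe c by (simp add: u_def h_def)
  ultimately show ?thesis
    using K KU u0 by blast
qed

end

section \<open>Linear algebra of para-hypercomplex structures\<close>

text \<open>Injectivity together with independence of the range is independence of the family
  \<open>b 1\<close>, \<open>b 2\<close>; with two vectors everything can be said by
  coefficients.\<close>

lemma ordered_bases_2_iff:
  fixes b :: "2 \<Rightarrow> 'v::real_vector"
  shows "b \<in> ordered_bases W \<longleftrightarrow>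
    (\<forall>x y. x *\<^sub>R b 1 + y *\<^sub>R b 2 = 0 \<longrightarrow> x = 0 \<and> y = 0) \<and> W = {x *\<^sub>R b 1 + y *\<^sub>R b 2 |x y. True}"
proof -
  have range: "range b = {b 1, b 2}" unfolding UNIV_2 by simp
  have inj: "inj b \<longleftrightarrow> b 1 \<noteq> b 2"
    unfolding inj_def by (auto simp: forall_2)
  have "z \<in> span (range b) \<longleftrightarrow> (\<exists>x y. z = x *\<^sub>R b 1 + y *\<^sub>R b 2)" for z
    unfolding range by (auto simp: span_breakdown_eq algebra_simps)
  then have span: "span (range b) = {x *\<^sub>R b 1 + y *\<^sub>R b 2 |x y. True}" by auto
  have "inj b \<and> independent (range b) \<longleftrightarrow> b 1 \<noteq> b 2 \<and> b 2 \<noteq> 0 \<and> (\<forall>k. b 1 \<noteq> k *\<^sub>R b 2)"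
    unfolding range inj by (auto simp: independent_insert span_breakdown_eq)
  also have "\<dots> \<longleftrightarrow> (\<forall>x y. x *\<^sub>R b 1 + y *\<^sub>R b 2 = 0 \<longrightarrow> x = 0 \<and> y = 0)"
  proof (intro iffI allI impI)
    fix x y assume *: "b 1 \<noteq> b 2 \<and> b 2 \<noteq> 0 \<and> (\<forall>k. b 1 \<noteq> k *\<^sub>R b 2)" "x *\<^sub>R b 1 + y *\<^sub>R b 2 = 0"
    have "x = 0"
    proof (rule ccontr)
      assume "x \<noteq> 0"
      have "x *\<^sub>R b 1 = - (y *\<^sub>R b 2)"
        using *(2) by (rule eq_neg_iff_add_eq_0[THEN iffD2])
      then have "inverse x *\<^sub>R (x *\<^sub>R b 1) = inverse x *\<^sub>R (- (y *\<^sub>R b 2))" by simp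
      with \<open>x \<noteq> 0\<close> have "b 1 = (- inverse x * y) *\<^sub>R b 2" by simp
      then show False using * by blast
    qed
    then show "x = 0 \<and> y = 0" using * by simp
  next
    assume *: "\<forall>x y. x *\<^sub>R b 1 + y *\<^sub>R b 2 = 0 \<longrightarrow> x = 0 \<and> y = 0"
    show "b 1 \<noteq> b 2 \<and> b 2 \<noteq> 0 \<and> (\<forall>k. b 1 \<noteq> k *\<^sub>R b 2)"
      using *[rule_format, of 1 "-1"] *[rule_format, of 0 1] *[rule_format, of 1 "- k" for k] by auto
  qed
  finally have "b \<in> ordered_bases W \<longleftrightarrow>
      (\<forall>x y. x *\<^sub>R b 1 + y *\<^sub>R b 2 = 0 \<longrightarrow> x = 0 \<and> y = 0) \<and> span (range b) = W"
    unfolding ordered_bases_def by blast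
  then show ?thesis unfolding span by blast
qed

section \<open>Alternating forms and orientations of a plane\<close>

definition alternating_form :: "'v::real_vector set \<Rightarrow> ('v \<Rightarrow> 'v \<Rightarrow> real) \<Rightarrow> bool" where
  "alternating_form V w \<longleftrightarrow>
     (\<forall>X\<in>V. \<forall>Y\<in>V. \<forall>Z\<in>V. w (X + Y) Z = w X Z + w Y Z) \<and>
     (\<forall>X\<in>V. \<forall>Y\<in>V. \<forall>r. w (r *\<^sub>R X) Y = r * w X Y) \<and>
     (\<forall>X\<in>V. \<forall>Y\<in>V. w Y X = - w X Y)"

lemma alternating_form_add:
  "alternating_form V w \<Longrightarrow> X \<in> V \<Longrightarrow> Y \<in> V \<Longrightarrow> Z \<in> V \<Longrightarrow> w (X + Y) Z = w X Z + w Y Z"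
  unfolding alternating_form_def by blast

lemma alternating_form_scale:
  "alternating_form V w \<Longrightarrow> X \<in> V \<Longrightarrow> Y \<in> V \<Longrightarrow> w (r *\<^sub>R X) Y = r * w X Y"
  unfolding alternating_form_def by blast

lemma alternating_form_swap:
  "alternating_form V w \<Longrightarrow> X \<in> V \<Longrightarrow> Y \<in> V \<Longrightarrow> w Y X = - w X Y"
  unfolding alternating_form_def by blast

text \<open>The coefficient is a 2 by 2 determinant. Suitable choices such as \<open>0 1\<close> or
  \<open>1 0\<close> for one pair of coefficients read off single coordinates of a vector.\<close>

lemma alternating_form_combination:
  assumes "subspace V" "alternating_form V w" "X \<in> V" "Y \<in> V"
  shows "w (a *\<^sub>R X + b *\<^sub>R Y) (c *\<^sub>R X + d *\<^sub>R Y) = (a * d - b * c) * w X Y"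
proof -
  note add = alternating_form_add[OF assms(2)] and scale = alternating_form_scale[OF assms(2)]
    and swap = alternating_form_swap[OF assms(2)]
  note mem = assms(3,4) subspace_add[OF assms(1)] subspace_scale[OF assms(1)]
  have self: "w Z Z = 0" if "Z \<in> V" for Z using swap[OF that that] by simp
  have left: "w (a *\<^sub>R X + b *\<^sub>R Y) Z = a * w X Z + b * w Y Z" if "Z \<in> V" for a b Z
    using that by (simp add: mem add scale)
  have right: "w Z (a *\<^sub>R X + b *\<^sub>R Y) = a * w Z X + b * w Z Y" if "Z \<in> V" for a b Z
  proof -
    have "w Z (a *\<^sub>R X + b *\<^sub>R Y) = - w (a *\<^sub>R X + b *\<^sub>R Y) Z"
      by (rule swap) (simp_all add: mem that)
    also have "\<dots> = a * (- w X Z) + b * (- w Y Z)"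
      by (simp add: left[OF that])
    also have "\<dots> = a * w Z X + b * w Z Y"
      using swap[OF mem(1) that] swap[OF mem(2) that] by simp
    finally show ?thesis .
  qed
  show ?thesis
    by (simp add: left right mem self swap[OF assms(3,4)] algebra_simps)
qed

lemma alternating_form_change_of_basis:
  fixes P :: "real ^ 2 ^ 2" and b b' :: "2 \<Rightarrow> 'v::real_vector"
  assumes "subspace V" "alternating_form V w" "b 1 \<in> V" "b 2 \<in> V"
    "\<forall>j. b' j = (\<Sum>i\<in>UNIV. P $ i $ j *\<^sub>R b i)"
  shows "w (b' 1) (b' 2) = det P * w (b 1) (b 2)"
proof -
  have b': "b' j = P $ 1 $ j *\<^sub>R b 1 + P $ 2 $ j *\<^sub>R b 2" for j
    using assms(5) by (simp add: sum_2)
  show ?thesis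
    unfolding b' alternating_form_combination[OF assms(1-4)] det_2 by (simp add: mult.commute)
qed

lemma ordered_bases_2_mem:
  fixes b :: "2 \<Rightarrow> 'v::real_vector"
  assumes "b \<in> ordered_bases V"
  shows "b i \<in> V"
  using assms unfolding ordered_bases_def by (auto intro: span_base)

lemma subspace_ordered_bases: "b \<in> ordered_bases V \<Longrightarrow> subspace V"
  unfolding ordered_bases_def by (auto intro: subspace_span)

lemma ordered_bases_2_expansion:
  fixes b :: "2 \<Rightarrow> 'v::real_vector"
  assumes "b \<in> ordered_bases V" "X \<in> V"
  obtains x y where "X = x *\<^sub>R b 1 + y *\<^sub>R b 2"
  using assms unfolding ordered_bases_2_iff by blast

text \<open>A change of basis multiplies the value of \<open>w\<close> by its determinant. So the
  class of a positive basis is exactly the set of positive bases, and a form can stand for an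
  orientation.\<close>

lemma same_orientation_iff:
  fixes b b' :: "2 \<Rightarrow> 'v::real_vector"
  assumes "alternating_form V w" "b \<in> ordered_bases V" "w (b 1) (b 2) > 0"
  shows "(b, b') \<in> same_orientation V \<longleftrightarrow> b' \<in> ordered_bases V \<and> w (b' 1) (b' 2) > 0"
proof (cases "b' \<in> ordered_bases V")
  case True
  have V: "subspace V" "b 1 \<in> V" "b 2 \<in> V"
    using assms(2) subspace_ordered_bases ordered_bases_2_mem by auto
  have sgn: "det P > 0 \<longleftrightarrow> w (b' 1) (b' 2) > 0"
    if "\<forall>j. b' j = (\<Sum>i\<in>UNIV. P $ i $ j *\<^sub>R b i)" for P :: "real ^ 2 ^ 2"
    using alternating_form_change_of_basis[OF V(1) assms(1) V(2,3) that] assms(3)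
    by (simp add: zero_less_mult_iff)
  have "\<forall>j. \<exists>x y. b' j = x *\<^sub>R b 1 + y *\<^sub>R b 2"
    using ordered_bases_2_expansion[OF assms(2)] ordered_bases_2_mem[OF True] by metis
  then obtain x y where xy: "\<And>j. b' j = x j *\<^sub>R b 1 + y j *\<^sub>R b 2" by metis
  define P :: "real ^ 2 ^ 2" where "P = (\<chi> i j. if i = 1 then x j else y j)"
  have "\<forall>j. b' j = (\<Sum>i\<in>UNIV. P $ i $ j *\<^sub>R b i)"
    by (simp add: P_def sum_2 xy)
  then show ?thesis
    using sgn True assms(2) unfolding same_orientation_def by blast
qed (simp add: same_orientation_def)

text \<open>Both bases differ from the representative of the class by a matrix of positive
  determinant, so \<open>w\<close> has the same sign on all three.\<close>

lemma orientation_alternating_form_pos: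
  fixes b b' :: "2 \<Rightarrow> 'v::real_vector"
  assumes "ori \<in> orientations V" "b \<in> ori" "b' \<in> ori" "alternating_form V w" "w (b 1) (b 2) > 0"
  shows "w (b' 1) (b' 2) > 0"
proof -
  obtain b0 where b0: "b0 \<in> ordered_bases V" "ori = same_orientation V `` {b0}"
    using assms(1) unfolding orientations_def quotient_def by blast
  obtain P :: "real ^ 2 ^ 2" where P: "det P > 0" "\<forall>j. b j = (\<Sum>i\<in>UNIV. P $ i $ j *\<^sub>R b0 i)"
    using assms(2) b0(2) unfolding same_orientation_def by blast
  have "w (b 1) (b 2) = det P * w (b0 1) (b0 2)"
    using alternating_form_change_of_basis[OF _ assms(4) _ _ P(2)] b0(1)
      subspace_ordered_bases ordered_bases_2_mem by blast
  then have "w (b0 1) (b0 2) > 0"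
    using assms(5) P(1) by (simp add: zero_less_mult_iff)
  then show ?thesis
    using same_orientation_iff[OF assms(4) b0(1)] assms(3) b0(2) by blast
qed

lemma orientation_mem_ordered_bases:
  "ori \<in> orientations V \<Longrightarrow> b \<in> ori \<Longrightarrow> b \<in> ordered_bases V"
  unfolding orientations_def quotient_def same_orientation_def by blast

text \<open>Pairing a vanishing combination with \<open>b' 2\<close> and \<open>b' 1\<close> kills
  its coefficients. For spanning, \<open>w (b' 1) (b' 2)\<close> is the determinant \<open>d\<close>
  of the coordinates of \<open>b'\<close> times the value on \<open>b\<close>, hence
  \<open>d\<close> is not 0.\<close>

lemma ordered_bases_2_of_alternating_form:
  fixes b b' :: "2 \<Rightarrow> 'v::real_vector"
  assumes "alternating_form V w" "b \<in> ordered_bases V" "b' 1 \<in> V" "b' 2 \<in> V" "w (b' 1) (b' 2) \<noteq> 0"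
  shows "b' \<in> ordered_bases V"
proof -
  have V: "subspace V" using assms(2) subspace_ordered_bases by blast
  note comb = alternating_form_combination[OF V assms(1)]
  have indep: "x = 0 \<and> y = 0" if "x *\<^sub>R b' 1 + y *\<^sub>R b' 2 = 0" for x y
    using comb[OF assms(3,4), of x y 0 1] comb[OF assms(3,4), of 1 0 x y]
      comb[OF assms(3,4), of 0 0 0 1] comb[OF assms(3,4), of 1 0 0 0] that assms(5) by simp
  have "\<exists>x y. Z = x *\<^sub>R b' 1 + y *\<^sub>R b' 2" if "Z \<in> V" for Z
  proof -
    obtain p1 p2 where p: "b' 1 = p1 *\<^sub>R b 1 + p2 *\<^sub>R b 2"
      using ordered_bases_2_expansion[OF assms(2,3)] by blast
    obtain q1 q2 where q: "b' 2 = q1 *\<^sub>R b 1 + q2 *\<^sub>R b 2"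
      using ordered_bases_2_expansion[OF assms(2,4)] by blast
    obtain z1 z2 where z: "Z = z1 *\<^sub>R b 1 + z2 *\<^sub>R b 2"
      using ordered_bases_2_expansion[OF assms(2) \<open>Z \<in> V\<close>] by blast
    define d where "d = p1 * q2 - p2 * q1"
    have "d \<noteq> 0"
      using assms(5) comb[OF ordered_bases_2_mem[OF assms(2), of 1] ordered_bases_2_mem[OF assms(2), of 2]]
      unfolding p q d_def by auto
    \<comment> \<open>Cramer's rule for the coordinates of \<open>Z\<close> with respect to
      \<open>b'\<close>.\<close>
    let ?x = "(z1 * q2 - z2 * q1) / d" and ?y = "(p1 * z2 - p2 * z1) / d"
    have "?x * p1 + ?y * q1 = z1" "?x * p2 + ?y * q2 = z2"
      using \<open>d \<noteq> 0\<close> by (simp_all add: field_simps) (simp_all add: d_def algebra_simps)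
    moreover have "?x *\<^sub>R b' 1 + ?y *\<^sub>R b' 2 = (?x * p1 + ?y * q1) *\<^sub>R b 1 + (?x * p2 + ?y * q2) *\<^sub>R b 2"
      unfolding p q by (simp add: scaleR_add_right scaleR_add_left)
    ultimately show ?thesis using z by metis
  qed
  then show ?thesis
    unfolding ordered_bases_2_iff using indep assms(3,4) V
    by (auto intro!: subspace_add subspace_scale)
qed

text \<open>Non-degeneracy is left to a separate argument, so that these forms make up a vector
  space, closed under cut-offs and sums. The condition for \<open>J3\<close> follows from those for
  \<open>J1\<close> and \<open>J2\<close>, since \<open>J3 = J1 J2\<close>.\<close>

definition compatible_form ::
  "'v::real_vector set \<Rightarrow> ('v \<Rightarrow> 'v) \<Rightarrow> ('v \<Rightarrow> 'v) \<Rightarrow> ('v \<Rightarrow> 'v \<Rightarrow> real) \<Rightarrow> bool" where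
  "compatible_form T J1 J2 g \<longleftrightarrow>
     (\<forall>X\<in>T. \<forall>Y\<in>T. \<forall>Z\<in>T. g (X + Y) Z = g X Z + g Y Z) \<and>
     (\<forall>X\<in>T. \<forall>Y\<in>T. \<forall>r. g (r *\<^sub>R X) Y = r * g X Y) \<and>
     (\<forall>X\<in>T. \<forall>Y\<in>T. g X Y = g Y X \<and> g (J1 X) (J1 Y) = g X Y \<and> g (J2 X) (J2 Y) = - g X Y)"

lemma compatible_form_zero: "compatible_form T J1 J2 (\<lambda>X Y. 0)"
  by (simp add: compatible_form_def)

lemma compatible_form_add:
  "compatible_form T J1 J2 g \<Longrightarrow> compatible_form T J1 J2 h \<Longrightarrow>
    compatible_form T J1 J2 (\<lambda>X Y. g X Y + h X Y)"
  by (simp add: compatible_form_def algebra_simps)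

lemma compatible_form_mult:
  "compatible_form T J1 J2 g \<Longrightarrow> compatible_form T J1 J2 (\<lambda>X Y. r * g X Y)"
  by (simp add: compatible_form_def algebra_simps)

lemma compatible_form_sum:
  "(\<And>i. i \<in> I \<Longrightarrow> compatible_form T J1 J2 (g i)) \<Longrightarrow> compatible_form T J1 J2 (\<lambda>X Y. \<Sum>i\<in>I. g i X Y)"
  by (induction I rule: infinite_finite_induct) (simp_all add: compatible_form_zero compatible_form_add)

section \<open>Para-hypercomplex structures on a vector space\<close>

locale para_hypercomplex_space =
  fixes T :: "'v::real_vector set" and J1 J2 :: "'v \<Rightarrow> 'v" and s :: real
  assumes subspace_T: "subspace T"
    and J1_mem: "X \<in> T \<Longrightarrow> J1 X \<in> T" and J2_mem: "X \<in> T \<Longrightarrow> J2 X \<in> T"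
    and J1_add: "X \<in> T \<Longrightarrow> Y \<in> T \<Longrightarrow> J1 (X + Y) = J1 X + J1 Y"
    and J2_add: "X \<in> T \<Longrightarrow> Y \<in> T \<Longrightarrow> J2 (X + Y) = J2 X + J2 Y"
    and J1_scale: "X \<in> T \<Longrightarrow> J1 (r *\<^sub>R X) = r *\<^sub>R J1 X"
    and J2_scale: "X \<in> T \<Longrightarrow> J2 (r *\<^sub>R X) = r *\<^sub>R J2 X"
    and J1_J1: "X \<in> T \<Longrightarrow> J1 (J1 X) = - X"
    and J2_J2: "X \<in> T \<Longrightarrow> J2 (J2 X) = X"
    and J2_J1: "X \<in> T \<Longrightarrow> J2 (J1 X) = - J1 (J2 X)"
    and sign: "s = 1 \<or> s = -1"
begin

abbreviation V :: "'v set" where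
  "V \<equiv> {X \<in> T. J2 X = s *\<^sub>R X}"

definition P :: "'v \<Rightarrow> 'v" where
  "P X = (1/2) *\<^sub>R X + (s/2) *\<^sub>R J2 X"

text \<open>If \<open>Q = 1 - P\<close> is the other projection, then \<open>K = - J1 \<circ> Q\<close> maps into \<open>V\<close> and \<open>X = P X + J1 (K X)\<close>.\<close>

definition K :: "'v \<Rightarrow> 'v" where
  "K X = (s/2) *\<^sub>R J1 (J2 X) + (-1/2) *\<^sub>R J1 X"

lemma ss: "s * s = 1" using sign by auto

lemma T_add: "X \<in> T \<Longrightarrow> Y \<in> T \<Longrightarrow> X + Y \<in> T"
  and T_scale: "X \<in> T \<Longrightarrow> r *\<^sub>R X \<in> T"
  and T_uminus: "X \<in> T \<Longrightarrow> - X \<in> T"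
  and T_diff: "X \<in> T \<Longrightarrow> Y \<in> T \<Longrightarrow> X - Y \<in> T"
  using subspace_T subspace_add subspace_scale subspace_neg subspace_diff by blast+

lemmas T_mem = T_add T_scale T_uminus T_diff J1_mem J2_mem

lemma J1_uminus: "X \<in> T \<Longrightarrow> J1 (- X) = - J1 X"
  using J1_scale[of X "-1"] by simp

lemma J2_uminus: "X \<in> T \<Longrightarrow> J2 (- X) = - J2 X"
  using J2_scale[of X "-1"] by simp

lemma J1_diff: "X \<in> T \<Longrightarrow> Y \<in> T \<Longrightarrow> J1 (X - Y) = J1 X - J1 Y"
  using J1_add[of X "- Y"] by (simp add: T_uminus J1_uminus)

lemma J2_diff: "X \<in> T \<Longrightarrow> Y \<in> T \<Longrightarrow> J2 (X - Y) = J2 X - J2 Y"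
  using J2_add[of X "- Y"] by (simp add: T_uminus J2_uminus)

lemmas J_simps = T_mem J1_add J1_diff J2_diff J2_add J1_scale J2_scale J1_uminus J2_uminus J1_J1 J2_J2 J2_J1

lemma half_half: "(1/2) *\<^sub>R (X::'v) + (1/2) *\<^sub>R X = X"
  by (simp flip: scaleR_add_left)

lemma P_mem_T: "X \<in> T \<Longrightarrow> P X \<in> T" and K_mem_T: "X \<in> T \<Longrightarrow> K X \<in> T"
  by (simp_all add: P_def K_def T_mem)

lemma P_mem: "X \<in> T \<Longrightarrow> P X \<in> V"
  using sign by (auto simp: P_def J_simps algebra_simps)

lemma K_mem: "X \<in> T \<Longrightarrow> K X \<in> V"
  using sign by (auto simp: K_def J_simps algebra_simps)

lemma P_add: "X \<in> T \<Longrightarrow> Y \<in> T \<Longrightarrow> P (X + Y) = P X + P Y"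
  and K_add: "X \<in> T \<Longrightarrow> Y \<in> T \<Longrightarrow> K (X + Y) = K X + K Y"
  and P_scale: "X \<in> T \<Longrightarrow> P (r *\<^sub>R X) = r *\<^sub>R P X"
  and K_scale: "X \<in> T \<Longrightarrow> K (r *\<^sub>R X) = r *\<^sub>R K X"
  by (simp_all add: P_def K_def J_simps algebra_simps)

text \<open>The pair \<open>(P X, K X)\<close> identifies \<open>T\<close> with two copies of
  \<open>V\<close>. There \<open>J1\<close> acts as \<open>(p, k) -> (-k, p)\<close> and
  \<open>J2\<close> as \<open>(p, k) -> (s p, -s k)\<close>.\<close>

lemma P_J1: "X \<in> T \<Longrightarrow> P (J1 X) = - K X"
  by (simp add: P_def K_def J_simps algebra_simps)

lemma K_J1: "X \<in> T \<Longrightarrow> K (J1 X) = P X"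
  by (simp add: P_def K_def J_simps algebra_simps)

lemma P_J2: "X \<in> T \<Longrightarrow> P (J2 X) = s *\<^sub>R P X"
  and K_J2: "X \<in> T \<Longrightarrow> K (J2 X) = - s *\<^sub>R K X"
  using sign by (auto simp: P_def K_def J_simps algebra_simps)

lemma P_eq: "X \<in> V \<Longrightarrow> P X = X"
  using ss by (simp add: P_def half_half)

lemma K_eq: "X \<in> V \<Longrightarrow> K X = 0"
  using ss by (simp add: K_def J_simps)

lemma decomposition:
  assumes "X \<in> T"
  shows "X = P X + J1 (K X)"
proof -
  have "P X + J1 (K X) = (1/2) *\<^sub>R X + (1/2) *\<^sub>R X"
    using assms by (simp add: P_def K_def J_simps)
  then show ?thesis by (simp add: half_half)
qed

lemma subspace_V: "subspace V"
  using subspace_0[OF subspace_T] J2_scale[of 0 0]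
  by (auto simp: subspace_def J_simps algebra_simps)

lemma
  assumes "compatible_form T J1 J2 g"
  shows form_add_left: "X \<in> T \<Longrightarrow> Y \<in> T \<Longrightarrow> Z \<in> T \<Longrightarrow> g (X + Y) Z = g X Z + g Y Z"
    and form_scale_left: "X \<in> T \<Longrightarrow> Y \<in> T \<Longrightarrow> g (r *\<^sub>R X) Y = r * g X Y"
    and form_sym: "X \<in> T \<Longrightarrow> Y \<in> T \<Longrightarrow> g X Y = g Y X"
    and form_J1: "X \<in> T \<Longrightarrow> Y \<in> T \<Longrightarrow> g (J1 X) (J1 Y) = g X Y"
    and form_J2: "X \<in> T \<Longrightarrow> Y \<in> T \<Longrightarrow> g (J2 X) (J2 Y) = - g X Y"
  using assms unfolding compatible_form_def by blast+

lemma form_add_right: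
  assumes "compatible_form T J1 J2 g" "X \<in> T" "Y \<in> T" "Z \<in> T"
  shows "g Z (X + Y) = g Z X + g Z Y"
  using form_add_left[OF assms] form_sym[OF assms(1)] assms(2-4) T_add by metis

lemma form_scale_right:
  assumes "compatible_form T J1 J2 g" "X \<in> T" "Y \<in> T"
  shows "g X (r *\<^sub>R Y) = r * g X Y"
  using form_scale_left[OF assms(1,3,2)] form_sym[OF assms(1)] assms(2,3) T_scale by metis

lemma form_sum_left:
  assumes "compatible_form T J1 J2 g" "finite I" "\<And>i. i \<in> I \<Longrightarrow> X i \<in> T" "Y \<in> T"
  shows "g (\<Sum>i\<in>I. r i *\<^sub>R X i) Y = (\<Sum>i\<in>I. r i * g (X i) Y)"
  using assms(2,3)
proof (induction I)
  case empty
  then show ?case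
    using form_scale_left[OF assms(1) assms(4) assms(4), of 0] by simp
next
  case (insert i I)
  have "(\<Sum>i\<in>I. r i *\<^sub>R X i) \<in> T"
    using insert.prems by (intro subspace_sum subspace_T T_scale) auto
  then show ?case
    using insert assms(4) by (simp add: form_add_left[OF assms(1)] form_scale_left[OF assms(1)] T_scale)
qed

lemma form_sum_right:
  assumes "compatible_form T J1 J2 g" "finite I" "\<And>i. i \<in> I \<Longrightarrow> X i \<in> T" "Y \<in> T"
  shows "g Y (\<Sum>i\<in>I. r i *\<^sub>R X i) = (\<Sum>i\<in>I. r i * g Y (X i))"
proof -
  have "(\<Sum>i\<in>I. r i *\<^sub>R X i) \<in> T"
    using assms(3) by (intro subspace_sum subspace_T T_scale) auto
  then have "g Y (\<Sum>i\<in>I. r i *\<^sub>R X i) = g (\<Sum>i\<in>I. r i *\<^sub>R X i) Y"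
    by (rule form_sym[OF assms(1,4)])
  also have "\<dots> = (\<Sum>i\<in>I. r i * g (X i) Y)"
    by (rule form_sum_left[OF assms])
  also have "\<dots> = (\<Sum>i\<in>I. r i * g Y (X i))"
    by (rule sum.cong[OF refl]) (simp add: form_sym[OF assms(1) assms(3) assms(4)])
  finally show ?thesis .
qed

lemma form_isotropic:
  assumes "compatible_form T J1 J2 g" "X \<in> V" "Y \<in> V"
  shows "g X Y = 0"
proof -
  have "- g X Y = g (s *\<^sub>R X) (s *\<^sub>R Y)"
    using form_J2[OF assms(1), of X Y] assms(2,3) by simp
  also have "\<dots> = (s * s) * g X Y"
    using assms by (simp add: form_scale_left form_scale_right T_scale)
  finally show ?thesis using ss by simp
qed

text \<open>\<open>J1\<close> preserves \<open>g\<close> and has square -1, so it is skew-adjoint: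
  \<open>g Y (J1 X) = - g (J1 Y) X\<close>.\<close>

lemma alternating_form_of_compatible:
  assumes "compatible_form T J1 J2 g"
  shows "alternating_form V (\<lambda>X Y. g X (J1 Y))"
proof -
  have swap: "g Y (J1 X) = - g X (J1 Y)" if "X \<in> T" "Y \<in> T" for X Y
  proof -
    have "g Y (J1 X) = g (J1 Y) ((-1) *\<^sub>R X)"
      using form_J1[OF assms, of Y "J1 X"] that by (simp add: J_simps)
    also have "\<dots> = - g (J1 Y) X"
      unfolding form_scale_right[OF assms J1_mem[OF that(2)] that(1)] by simp
    finally show ?thesis using form_sym[OF assms J1_mem[OF that(2)] that(1)] by simp
  qed
  show ?thesis
    unfolding alternating_form_def
    by (intro conjI ballI allI; (rule form_add_left[OF assms] form_scale_left[OF assms] swap; simp add: J1_mem))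
qed

text \<open>\<open>V\<close> and \<open>J1 V\<close> are isotropic and are paired by
  \<open>w\<close>, which is non-degenerate on a plane once it is non-zero. Testing \<open>Z\<close>
  against \<open>J1 (b i)\<close> sees only \<open>P Z\<close>; testing it against
  \<open>J1 (J1 (b i))\<close>, which is \<open>- b i\<close>, then sees \<open>K Z\<close>.\<close>

lemma compatible_form_nondegenerate:
  fixes b :: "2 \<Rightarrow> 'v"
  assumes g: "compatible_form T J1 J2 g" and b: "b \<in> ordered_bases V"
    and nz: "g (b 1) (J1 (b 2)) \<noteq> 0" and Z: "Z \<in> T" "\<And>Y. Y \<in> T \<Longrightarrow> g Z Y = 0"
  shows "Z = 0"
proof -
  let ?w = "\<lambda>X Y. g X (J1 Y)"
  note w = alternating_form_of_compatible[OF g]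
  have bV: "b i \<in> V" for i using ordered_bases_2_mem[OF b] .
  then have bT: "b i \<in> T" for i by blast
  note PT = P_mem_T[OF Z(1)] and KT = K_mem_T[OF Z(1)]
  have zero: "X = 0" if X: "X \<in> V" and w0: "?w X (b 1) = 0" "?w X (b 2) = 0" for X
  proof -
    obtain x y where xy: "X = x *\<^sub>R b 1 + y *\<^sub>R b 2"
      using ordered_bases_2_expansion[OF b X] by blast
    have "?w X (b 2) = x * ?w (b 1) (b 2)" "?w X (b 1) = - y * ?w (b 1) (b 2)"
      using alternating_form_combination[OF subspace_V w bV[of 1] bV[of 2], of x y 0 1]
        alternating_form_combination[OF subspace_V w bV[of 1] bV[of 2], of x y 1 0]
      by (simp_all add: xy)
    then show ?thesis using w0 nz xy by simp
  qed
  have "?w (P Z) (b i) = 0" for i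
  proof -
    have "g Z (J1 (b i)) = g (P Z) (J1 (b i)) + g (J1 (K Z)) (J1 (b i))"
      using form_add_left[OF g PT J1_mem[OF KT] J1_mem[OF bT]] decomposition[OF Z(1)] by simp
    then show ?thesis
      using Z(2)[OF J1_mem[OF bT]] form_J1[OF g KT bT] form_isotropic[OF g K_mem[OF Z(1)] bV] by simp
  qed
  then have P0: "P Z = 0" using zero P_mem[OF Z(1)] by blast
  then have ZK: "Z = J1 (K Z)" using decomposition[OF Z(1)] by simp
  have "?w (K Z) (b i) = 0" for i
  proof -
    have "g (K Z) (J1 (b i)) = g (J1 (K Z)) (J1 (J1 (b i)))"
      using form_J1[OF g KT J1_mem[OF bT]] by simp
    also have "\<dots> = g Z (J1 (J1 (b i)))" using ZK by simp
    finally show ?thesis using Z(2)[OF J1_mem[OF J1_mem[OF bT]]] by simp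
  qed
  then have "K Z = 0" using zero K_mem[OF Z(1)] by blast
  then show ?thesis
    using ZK J1_scale[OF Z(1), of 0] by simp
qed

text \<open>Otherwise \<open>b 1\<close> would be orthogonal to \<open>V\<close> by isotropy, and to
  \<open>J1 V\<close> because \<open>w (b 1)\<close> vanishes on both basis vectors; by the
  decomposition it would be orthogonal to all of \<open>T\<close>.\<close>

lemma nondegenerate_imp_nonzero:
  fixes b :: "2 \<Rightarrow> 'v"
  assumes g: "compatible_form T J1 J2 g" and b: "b \<in> ordered_bases V"
    and nd: "\<And>X. X \<in> T \<Longrightarrow> (\<And>Y. Y \<in> T \<Longrightarrow> g X Y = 0) \<Longrightarrow> X = 0"
  shows "g (b 1) (J1 (b 2)) \<noteq> 0"
proof
  assume 0: "g (b 1) (J1 (b 2)) = 0"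
  have bV: "b i \<in> V" for i using ordered_bases_2_mem[OF b] .
  have "g (b 1) Y = 0" if Y: "Y \<in> T" for Y
  proof -
    obtain x y where xy: "K Y = x *\<^sub>R b 1 + y *\<^sub>R b 2"
      using ordered_bases_2_expansion[OF b K_mem[OF Y]] by blast
    have "g (b 1) Y = g (b 1) (P Y) + g (b 1) (J1 (K Y))"
      using form_add_right[OF g P_mem_T[OF Y] J1_mem[OF K_mem_T[OF Y]]] bV decomposition[OF Y] by simp
    moreover have "g (b 1) (P Y) = 0" using form_isotropic[OF g bV P_mem[OF Y]] .
    moreover have "g (b 1) (J1 (K Y)) = y * g (b 1) (J1 (b 2))"
      using alternating_form_combination[OF subspace_V alternating_form_of_compatible[OF g] bV[of 1] bV[of 2], of 1 0 x y]
      by (simp add: xy)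
    ultimately show ?thesis using 0 by simp
  qed
  then have "b 1 = 0" using nd bV by blast
  then have "1 *\<^sub>R b 1 + 0 *\<^sub>R b 2 = 0" by simp
  then show False using b unfolding ordered_bases_2_iff by fastforce
qed

text \<open>The only candidate: expand \<open>g X Y\<close> with \<open>X = P X + J1 (K X)\<close>
  and likewise for \<open>Y\<close>; isotropy removes the pure terms, and the mixed ones are values
  of \<open>w\<close>.\<close>

definition form_of :: "('v \<Rightarrow> 'v \<Rightarrow> real) \<Rightarrow> 'v \<Rightarrow> 'v \<Rightarrow> real" where
  "form_of w X Y = w (P X) (K Y) + w (P Y) (K X)"

text \<open>\<open>J1\<close> replaces \<open>(P, K)\<close> by \<open>(-K, P)\<close>, and
  skew-symmetry of \<open>w\<close> returns the two terms in exchanged order. \<open>J2\<close>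
  contributes the factors \<open>s\<close> and \<open>-s\<close>, hence -1.\<close>

lemma compatible_form_form_of:
  assumes "alternating_form V w"
  shows "compatible_form T J1 J2 (form_of w)"
proof -
  note add = alternating_form_add[OF assms] and scale = alternating_form_scale[OF assms]
    and swap = alternating_form_swap[OF assms]
  note V_scale = subspace_scale[OF subspace_V] and V_add = subspace_add[OF subspace_V]
  have add': "w Z (X + Y) = w Z X + w Z Y" if "X \<in> V" "Y \<in> V" "Z \<in> V" for X Y Z
    using add[OF that] swap[OF V_add[OF that(1,2)] that(3)] swap[OF that(1,3)] swap[OF that(2,3)] by simp
  have scale': "w X (r *\<^sub>R Y) = r * w X Y" if "X \<in> V" "Y \<in> V" for X Y r
    using scale[OF that(2,1)] swap[OF V_scale[OF that(2)] that(1)] swap[OF that(2,1)] by simp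
  have uminus: "w (- X) Y = - w X Y" if "X \<in> V" "Y \<in> V" for X Y
    using scale[OF that, of "-1"] by simp
  show ?thesis
    unfolding compatible_form_def form_of_def
  proof (intro conjI ballI allI)
    fix X Y Z assume "X \<in> T" "Y \<in> T" "Z \<in> T"
    note PK = P_mem[OF this(1)] P_mem[OF this(2)] P_mem[OF this(3)]
      K_mem[OF this(1)] K_mem[OF this(2)] K_mem[OF this(3)]
    show "w (P (X + Y)) (K Z) + w (P Z) (K (X + Y)) =
        w (P X) (K Z) + w (P Z) (K X) + (w (P Y) (K Z) + w (P Z) (K Y))"
      unfolding P_add[OF \<open>X \<in> T\<close> \<open>Y \<in> T\<close>] K_add[OF \<open>X \<in> T\<close> \<open>Y \<in> T\<close>]
        add[OF PK(1,2,6)] add'[OF PK(4,5,3)] by simp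
  next
    fix X Y r assume XY: "X \<in> T" "Y \<in> T"
    note PK = P_mem[OF XY(1)] P_mem[OF XY(2)] K_mem[OF XY(1)] K_mem[OF XY(2)]
    show "w (P (r *\<^sub>R X)) (K Y) + w (P Y) (K (r *\<^sub>R X)) = r * (w (P X) (K Y) + w (P Y) (K X))"
      unfolding P_scale[OF XY(1)] K_scale[OF XY(1)] scale[OF PK(1,4)] scale'[OF PK(2,3)]
      by (simp add: algebra_simps)
  next
    fix X Y assume XY: "X \<in> T" "Y \<in> T"
    note PK = P_mem[OF XY(1)] P_mem[OF XY(2)] K_mem[OF XY(1)] K_mem[OF XY(2)]
    show "w (P X) (K Y) + w (P Y) (K X) = w (P Y) (K X) + w (P X) (K Y)" by simp
    show "w (P (J1 X)) (K (J1 Y)) + w (P (J1 Y)) (K (J1 X)) = w (P X) (K Y) + w (P Y) (K X)"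
      unfolding P_J1[OF XY(1)] P_J1[OF XY(2)] K_J1[OF XY(1)] K_J1[OF XY(2)]
        uminus[OF PK(3,2)] uminus[OF PK(4,1)]
      using swap[OF PK(3,2)] swap[OF PK(4,1)] by simp
    have "w (s *\<^sub>R P X) ((- s) *\<^sub>R K Y) + w (s *\<^sub>R P Y) ((- s) *\<^sub>R K X) =
        - (s * s) * (w (P X) (K Y) + w (P Y) (K X))"
      unfolding scale[OF PK(1) V_scale[OF PK(4)]] scale[OF PK(2) V_scale[OF PK(3)]]
        scale'[OF PK(1,4)] scale'[OF PK(2,3)] by (simp add: algebra_simps)
    then show "w (P (J2 X)) (K (J2 Y)) + w (P (J2 Y)) (K (J2 X)) = - (w (P X) (K Y) + w (P Y) (K X))"
      unfolding P_J2[OF XY(1)] P_J2[OF XY(2)] K_J2[OF XY(1)] K_J2[OF XY(2)] ss by simp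
  qed
qed

lemma form_of_J1:
  assumes "alternating_form V w" "X \<in> V" "Y \<in> V"
  shows "form_of w X (J1 Y) = w X Y"
proof -
  \<comment> \<open>In the second term of \<open>form_of\<close>, \<open>K X\<close> and
    \<open>P (J1 Y) = - K Y\<close> both vanish.\<close>
  have "w 0 0 = 0"
    using assms unfolding alternating_form_def
    by (metis (no_types, lifting) mult_zero_left scaleR_zero_left subspace_0 subspace_V)
  then show ?thesis
    using assms(2,3) P_eq[OF assms(2)] P_eq[OF assms(3)] K_eq[OF assms(2)] K_eq[OF assms(3)]
    by (simp add: form_of_def P_J1 K_J1)
qed

end

text \<open>\<open>J1\<close> maps \<open>V\<close> injectively into the other eigenspace, which
  meets \<open>V\<close> only in 0, and \<open>V\<close> and \<open>J1 V\<close> together span by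
  the decomposition. Counting dimensions, 4 is twice the dimension of \<open>V\<close>.\<close>

lemma eigenspace_ordered_basis:
  fixes J1 J2 :: "real^4 \<Rightarrow> real^4"
  assumes "para_hypercomplex_space UNIV J1 J2 s"
  obtains b :: "2 \<Rightarrow> real^4" where "b \<in> ordered_bases {v. J2 v = s *\<^sub>R v}"
proof -
  interpret para_hypercomplex_space UNIV J1 J2 s by fact
  let ?V = "{v. J2 v = s *\<^sub>R v}"
  have V: "subspace ?V" using subspace_V by simp
  have lin: "linear J1" by (rule linearI) (simp_all add: J_simps)
  have inj: "inj_on J1 S" for S
    by (rule inj_onI) (metis J1_J1 UNIV_I neg_equal_iff_equal)
  have image: "subspace (J1 ` ?V)" using linear_subspace_image[OF lin V] .
  have "?V \<inter> J1 ` ?V = {0}"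
  proof
    show "?V \<inter> J1 ` ?V \<subseteq> {0}"
    proof
      fix x assume "x \<in> ?V \<inter> J1 ` ?V"
      then obtain v where v: "J2 x = s *\<^sub>R x" "x = J1 v" "J2 v = s *\<^sub>R v" by blast
      have "J2 x = - s *\<^sub>R x" unfolding v(2) by (simp add: J_simps v(3))
      then have "2 *\<^sub>R x = 0" using v(1) sign by (auto simp: scaleR_2)
      then show "x \<in> {0}" by simp
    qed
  qed (use subspace_0[OF V] subspace_0[OF image] in blast)
  moreover have "{x + y |x y. x \<in> ?V \<and> y \<in> J1 ` ?V} = UNIV"
  proof -
    have "x \<in> {x + y |x y. x \<in> ?V \<and> y \<in> J1 ` ?V}" for x
      using decomposition[of x] P_mem[of x] K_mem[of x] by auto
    then show ?thesis by blast
  qed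
  moreover have "dim (J1 ` ?V) = dim ?V"
    by (rule dim_image_eq[OF lin inj])
  ultimately have "dim (UNIV :: (real^4) set) + dim {0 :: real^4} = dim ?V + dim ?V"
    using dim_sums_Int[OF V image] by simp
  then have dim: "dim ?V = 2" by (simp add: dim_UNIV)
  obtain B where B: "B \<subseteq> ?V" "independent B" "?V \<subseteq> span B" "card B = dim ?V"
    by (rule basis_exists[of ?V])
  then obtain x y where xy: "B = {x, y}" "x \<noteq> y" unfolding dim card_2_iff by blast
  define b :: "2 \<Rightarrow> real^4" where "b i = (if i = 1 then x else y)" for i
  have "range b = B" unfolding UNIV_2 by (auto simp: b_def xy)
  moreover have "inj b" using xy(2) by (auto simp: inj_def forall_2 b_def)
  moreover have "span B = ?V" by (rule span_subspace[OF B(1,3) V])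
  ultimately show thesis
    using B(2) that unfolding ordered_bases_def by blast
qed

section \<open>The determinant of four vectors\<close>

lemma vector_4:
  "(vector [w, x, y, z] :: 'a::zero ^ 4) $ 1 = w"
  "(vector [w, x, y, z] :: 'a::zero ^ 4) $ 2 = x"
  "(vector [w, x, y, z] :: 'a::zero ^ 4) $ 3 = y"
  "(vector [w, x, y, z] :: 'a::zero ^ 4) $ 4 = z"
  unfolding vector_def by simp_all

text \<open>Serves as an alternating form in the first two arguments while the last two are held
  fixed, which is why the rules below concern the first row and the exchange of the first
  two.\<close>

definition vol4 :: "real^4 \<Rightarrow> real^4 \<Rightarrow> real^4 \<Rightarrow> real^4 \<Rightarrow> real" where
  "vol4 w x y z = det (vector [w, x, y, z] :: real^4^4)"

text \<open>Isolates the first row in the shape that the rules for row operations expect. The entry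
  \<open>0\<close> is a filler that is never read.\<close>

lemma vector_4_row:
  "(vector [w, x, y, z] :: real^4^4) = (\<chi> i. if i = 1 then w else vector [0, x, y, z] $ i)"
  by (simp add: vec_eq_iff forall_4 vector_4)

lemma vol4_add: "vol4 (w + w') x y z = vol4 w x y z + vol4 w' x y z"
  using det_row_add[of 1 "\<lambda>_. w" "\<lambda>_. w'" "($) (vector [0, x, y, z])"]
  by (simp add: vol4_def flip: vector_4_row)

lemma vol4_scale: "vol4 (r *\<^sub>R w) x y z = r * vol4 w x y z"
  using det_row_mul[of 1 r "\<lambda>_. w" "($) (vector [0, x, y, z])"]
  by (simp add: vol4_def scalar_mult_eq_scaleR flip: vector_4_row)

lemma vol4_swap: "vol4 x w y z = - vol4 w x y z"
proof -
  have "vector [w, x, y, z] = (\<chi> i. (vector [x, w, y, z] :: real^4^4) $ Transposition.transpose 1 2 i)"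
    by (simp add: vec_eq_iff forall_4 vector_4 Transposition.transpose_def)
  then have "vol4 w x y z = - vol4 x w y z"
    unfolding vol4_def
    using det_permute_rows[of "Transposition.transpose 1 2" "vector [x, w, y, z] :: real^4^4"]
    by (simp add: permutes_swap_id sign_swap_id)
  then show ?thesis by simp
qed

lemma vol4_nonzero:
  assumes "span {w, x, y, z} = UNIV"
  shows "vol4 w x y z \<noteq> 0"
proof -
  let ?A = "vector [w, x, y, z] :: real^4^4"
  have "rows ?A = (\<lambda>i. row i ?A) ` {1, 2, 3, 4}"
    unfolding rows_def UNIV_4[symmetric] by auto
  then have "rows ?A = {w, x, y, z}"
    by (simp add: row_def vector_4)
  then have "\<exists>B. B ** ?A = mat 1"
    using assms matrix_left_invertible_span_rows by metis
  then have "invertible ?A" using invertible_left_inverse by blast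
  then show ?thesis unfolding vol4_def invertible_det_nz .
qed

section \<open>Compatible metrics and orientations\<close>

text \<open>The smoothness clause of a metric, localised to \<open>U\<close> and separated from the
  algebraic conditions, so that local forms can be cut off and glued.\<close>

definition smooth_form_on ::
  "('a, 'e::euclidean_space) chart set \<Rightarrow> 'a set \<Rightarrow> ('a, 'e) form_field \<Rightarrow> bool" where
  "smooth_form_on A U g \<longleftrightarrow> (\<forall>c\<in>A. \<forall>u\<in>Basis. \<forall>v\<in>Basis.
     smooth_fun_on A (U \<inter> chart_dom c) (\<lambda>q. g q (chart_vector A c u q) (chart_vector A c v q)))"

context smooth_manifold
begin

text \<open>The determinant is a polynomial in the coordinates of its rows.\<close>

lemma smooth_fun_on_vol4:
  assumes U: "open U" and f: "smooth_fun_on A U f1" "smooth_fun_on A U f2"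
    "smooth_fun_on A U f3" "smooth_fun_on A U f4"
  shows "smooth_fun_on A U (\<lambda>q. vol4 (f1 q) (f2 q) (f3 q) (f4 q))"
proof -
  have "\<forall>i. smooth_fun_on A U (\<lambda>q. (vector [f1 q, f2 q, f3 q, f4 q] :: real^4^4) $ i $ j)" for j
    unfolding forall_4 vector_4
    by (intro conjI smooth_fun_on_bounded_linear[OF bounded_linear_vec_nth U] f)
  then show ?thesis
    unfolding vol4_def det_def
    by (intro smooth_fun_on_sum smooth_fun_on_mult smooth_fun_on_prod smooth_fun_on_const U) blast
qed

lemma smooth_form_onI:
  assumes "\<And>c u v. c \<in> A \<Longrightarrow> u \<in> Basis \<Longrightarrow> v \<in> Basis \<Longrightarrow>
    smooth_fun_on A (U \<inter> chart_dom c) (\<lambda>q. g q (chart_vector A c u q) (chart_vector A c v q))"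
  shows "smooth_form_on A U g"
  using assms unfolding smooth_form_on_def by blast

lemma smooth_form_onD:
  "smooth_form_on A U g \<Longrightarrow> c \<in> A \<Longrightarrow> u \<in> Basis \<Longrightarrow> v \<in> Basis \<Longrightarrow>
    smooth_fun_on A (U \<inter> chart_dom c) (\<lambda>q. g q (chart_vector A c u q) (chart_vector A c v q))"
  unfolding smooth_form_on_def by blast

lemma smooth_form_on_subset:
  assumes "smooth_form_on A U g" "W \<subseteq> U"
  shows "smooth_form_on A W g"
  by (rule smooth_form_onI, rule smooth_fun_on_subset[OF smooth_form_onD[OF assms(1)]])
    (use assms(2) in auto)

lemma smooth_form_on_cong:
  assumes "open U" "\<And>q X Y. q \<in> U \<Longrightarrow> g q X Y = h q X Y" "smooth_form_on A U g"
  shows "smooth_form_on A U h"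
proof (rule smooth_form_onI)
  fix c and u v :: 'e assume c: "c \<in> A" "u \<in> Basis" "v \<in> Basis"
  have W: "open (U \<inter> chart_dom c)" using assms(1) c open_chart_dom by blast
  show "smooth_fun_on A (U \<inter> chart_dom c) (\<lambda>q. h q (chart_vector A c u q) (chart_vector A c v q))"
    by (rule smooth_fun_on_cong[OF W, THEN iffD1, rotated, OF smooth_form_onD[OF assms(3) c]])
      (simp add: assms(2))
qed

lemma smooth_form_on_locally:
  assumes "open U" "\<And>p. p \<in> U \<Longrightarrow> \<exists>W. open W \<and> p \<in> W \<and> smooth_form_on A (U \<inter> W) g"
  shows "smooth_form_on A U g"
proof (rule smooth_form_onI)
  fix c and u v :: 'e assume c: "c \<in> A" "u \<in> Basis" "v \<in> Basis"
  show "smooth_fun_on A (U \<inter> chart_dom c) (\<lambda>q. g q (chart_vector A c u q) (chart_vector A c v q))"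
  proof (rule smooth_fun_on_locally)
    show "open (U \<inter> chart_dom c)" using assms(1) c open_chart_dom by blast
  next
    fix p assume "p \<in> U \<inter> chart_dom c"
    then obtain W where W: "open W" "p \<in> W" "smooth_form_on A (U \<inter> W) g" using assms(2) by blast
    have "U \<inter> chart_dom c \<inter> W = U \<inter> W \<inter> chart_dom c" by blast
    then show "\<exists>W. open W \<and> p \<in> W \<and> smooth_fun_on A (U \<inter> chart_dom c \<inter> W)
        (\<lambda>q. g q (chart_vector A c u q) (chart_vector A c v q))"
      using W smooth_form_onD[OF W(3) c] by (intro exI[of _ W]) simp
  qed
qed

lemma smooth_form_on_sum:
  assumes "open U" "\<And>i. i \<in> I \<Longrightarrow> smooth_form_on A U (g i)"
  shows "smooth_form_on A U (\<lambda>q X Y. \<Sum>i\<in>I. g i q X Y)"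
proof (rule smooth_form_onI)
  fix c and u v :: 'e assume c: "c \<in> A" "u \<in> Basis" "v \<in> Basis"
  show "smooth_fun_on A (U \<inter> chart_dom c)
      (\<lambda>q. \<Sum>i\<in>I. g i q (chart_vector A c u q) (chart_vector A c v q))"
    by (rule smooth_fun_on_sum[OF open_Int[OF assms(1) open_chart_dom[OF c(1)]]])
      (rule smooth_form_onD[OF assms(2) c])
qed

lemma smooth_form_on_mult:
  assumes "open U" "smooth_fun_on A U f" "smooth_form_on A U g"
  shows "smooth_form_on A U (\<lambda>q X Y. f q * g q X Y)"
proof (rule smooth_form_onI)
  fix c and u v :: 'e assume c: "c \<in> A" "u \<in> Basis" "v \<in> Basis"
  show "smooth_fun_on A (U \<inter> chart_dom c)
      (\<lambda>q. f q * g q (chart_vector A c u q) (chart_vector A c v q))"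
    by (rule smooth_fun_on_mult[OF open_Int[OF assms(1) open_chart_dom[OF c(1)]]
      smooth_fun_on_subset[OF assms(2) Int_lower1] smooth_form_onD[OF assms(3) c]])
qed

lemma smooth_form_on_zero: "open U \<Longrightarrow> smooth_form_on A U (\<lambda>q X Y. 0)"
  by (intro smooth_form_onI smooth_fun_on_const open_Int open_chart_dom)

lemma smooth_form_on_carrier_iff:
  "smooth_form_on A M g \<longleftrightarrow> (\<forall>c\<in>A. \<forall>u\<in>Basis. \<forall>v\<in>Basis. smooth_on (chart_map c ` chart_dom c)
     (\<lambda>y. g (chart_inv c y) (chart_vector A c u (chart_inv c y)) (chart_vector A c v (chart_inv c y))))"
proof -
  have M: "M \<inter> chart_dom c = chart_dom c" if "c \<in> A" for c
    using that carrierI by blast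
  have "smooth_fun_on A (chart_dom c) f \<longleftrightarrow> smooth_on (chart_map c ` chart_dom c) (\<lambda>y. f (chart_inv c y))"
    if "c \<in> A" for c and f :: "'a \<Rightarrow> real"
    using smooth_fun_onD[of "chart_dom c" f c] smooth_fun_on_single_chart[of c "chart_dom c" f]
      open_chart_dom that by auto
  then show ?thesis unfolding smooth_form_on_def using M by simp
qed

end

section \<open>The eigenbundle and its projections on the manifold\<close>

locale para_hypercomplex_manifold = smooth_manifold A
  for A :: "('a::{t2_space,second_countable_topology}, real^4) chart set" +
  fixes J1 J2 J3 :: "('a, real^4) endo_field" and s :: real
  assumes para_hypercomplex: "almost_para_hypercomplex A J1 J2 J3" and sign: "s = 1 \<or> s = -1"
begin

abbreviation V :: "'a \<Rightarrow> (('a, real^4) chart \<Rightarrow> real^4) set" where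
  "V p \<equiv> eigenbundle A J2 s p"

lemma smooth_J: "smooth_endomorphism A J1" "smooth_endomorphism A J2"
  using para_hypercomplex unfolding almost_para_hypercomplex_def by blast+

lemma endo_mem: "smooth_endomorphism A J \<Longrightarrow> p \<in> M \<Longrightarrow> X \<in> T p \<Longrightarrow> J p X \<in> T p"
  and endo_add: "smooth_endomorphism A J \<Longrightarrow> p \<in> M \<Longrightarrow> X \<in> T p \<Longrightarrow> Y \<in> T p \<Longrightarrow>
    J p (X + Y) = J p X + J p Y"
  and endo_scale: "smooth_endomorphism A J \<Longrightarrow> p \<in> M \<Longrightarrow> X \<in> T p \<Longrightarrow>
    J p (r *\<^sub>R X) = r *\<^sub>R J p X"
  unfolding smooth_endomorphism_def by blast+

lemma J_relations:
  assumes "p \<in> M" "X \<in> T p"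
  shows "J1 p (J1 p X) = - X" "J2 p (J2 p X) = X" "J2 p (J1 p X) = - J1 p (J2 p X)"
    "J3 p X = J1 p (J2 p X)"
proof -
  have *: "J1 p (J1 p X) = - X" "- J2 p (J2 p X) = - X" "J1 p (J2 p X) = - J2 p (J1 p X)"
    "J1 p (J2 p X) = J3 p X"
    using para_hypercomplex assms unfolding almost_para_hypercomplex_def by blast+
  show "J1 p (J1 p X) = - X" "J3 p X = J1 p (J2 p X)" by (fact *(1), fact *(4)[symmetric])
  show "J2 p (J2 p X) = X" by (rule neg_equal_iff_equal[THEN iffD1, OF *(2)])
  show "J2 p (J1 p X) = - J1 p (J2 p X)" by (rule equation_minus_iff[THEN iffD1, OF *(3)])
qed

lemma para_hypercomplex_tangent_space:
  assumes "p \<in> M"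
  shows "para_hypercomplex_space (T p) (J1 p) (J2 p) s"
  by unfold_locales (fact subspace_tangent sign endo_mem[OF smooth_J(1) assms] endo_mem[OF smooth_J(2) assms]
    endo_add[OF smooth_J(1) assms] endo_add[OF smooth_J(2) assms]
    endo_scale[OF smooth_J(1) assms] endo_scale[OF smooth_J(2) assms]
    J_relations(1)[OF assms] J_relations(2)[OF assms] J_relations(3)[OF assms])+

text \<open>A chart identifies \<open>T p\<close> with \<open>real^4\<close>. The structure is moved
  there as \<open>j1\<close>, \<open>j2\<close>, where dimensions can be counted, and the resulting
  basis is carried back.\<close>

lemma V_basis_exists:
  assumes p: "p \<in> M"
  obtains b :: "2 \<Rightarrow> ('a, real^4) chart \<Rightarrow> real^4" where "b \<in> ordered_bases (V p)"
proof -
  obtain c where c: "c \<in> A" "p \<in> chart_dom c" using p carrierE by blast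
  let ?f = "\<lambda>v. chart_vector A c v p"
  have lin: "linear ?f" using linear_chart_vector[OF c] .
  have fT: "?f v \<in> T p" for v using chart_vector_tangent[OF c] .
  have fc: "?f v c = v" for v using chart_vector_same[OF c] .
  define j1 where "j1 v = J1 p (?f v) c" for v
  define j2 where "j2 v = J2 p (?f v) c" for v
  have f_j: "?f (j1 v) = J1 p (?f v)" "?f (j2 v) = J2 p (?f v)" for v
    unfolding j1_def j2_def
    using tangent_eq_chart_vector[OF endo_mem[OF smooth_J(1) p fT] c]
      tangent_eq_chart_vector[OF endo_mem[OF smooth_J(2) p fT] c] by metis+
  have inj: "v = w" if "?f v = ?f w" for v w
    using fc[of v] fc[of w] that by metis
  have "para_hypercomplex_space UNIV j1 j2 s"
  proof
    show "j1 (X + Y) = j1 X + j1 Y" "j2 (X + Y) = j2 X + j2 Y" for X Y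
      by (rule inj; simp only: linear_add[OF lin] f_j endo_add[OF smooth_J(1) p fT fT]
        endo_add[OF smooth_J(2) p fT fT])+
    show "j1 (r *\<^sub>R X) = r *\<^sub>R j1 X" "j2 (r *\<^sub>R X) = r *\<^sub>R j2 X" for r X
      by (rule inj; simp only: linear_scale[OF lin] f_j endo_scale[OF smooth_J(1) p fT]
        endo_scale[OF smooth_J(2) p fT])+
    show "j1 (j1 X) = - X" "j2 (j2 X) = X" "j2 (j1 X) = - j1 (j2 X)" for X
      by (rule inj; simp only: linear_neg[OF lin] f_j J_relations[OF p fT])+
  qed (use sign in auto)
  then obtain b :: "2 \<Rightarrow> real^4" where b: "b \<in> ordered_bases {v. j2 v = s *\<^sub>R v}"
    using eigenspace_ordered_basis by blast
  have comb: "?f (x *\<^sub>R b 1 + y *\<^sub>R b 2) = x *\<^sub>R ?f (b 1) + y *\<^sub>R ?f (b 2)" for x y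
    by (simp only: linear_add[OF lin] linear_scale[OF lin])
  have "X \<in> V p \<longleftrightarrow> (\<exists>x y. X = x *\<^sub>R ?f (b 1) + y *\<^sub>R ?f (b 2))" for X
  proof -
    have "X \<in> V p \<longleftrightarrow> (\<exists>v. X = ?f v \<and> j2 v = s *\<^sub>R v)"
    proof
      assume "X \<in> V p"
      then have X: "X \<in> T p" "J2 p X = s *\<^sub>R X" unfolding eigenbundle_def by blast+
      have Xf: "X = ?f (X c)" using tangent_eq_chart_vector[OF X(1) c] .
      have "j2 (X c) = s *\<^sub>R X c"
        using X(2) unfolding j2_def Xf[symmetric] by (simp only: scaleR_fun_apply)
      then show "\<exists>v. X = ?f v \<and> j2 v = s *\<^sub>R v" using Xf by blast
    next
      assume "\<exists>v. X = ?f v \<and> j2 v = s *\<^sub>R v"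
      then obtain v where v: "X = ?f v" "j2 v = s *\<^sub>R v" by blast
      then have "J2 p X = s *\<^sub>R X" using f_j(2)[of v] linear_scale[OF lin] by metis
      then show "X \<in> V p" unfolding eigenbundle_def using v fT by blast
    qed
    also have "\<dots> \<longleftrightarrow> (\<exists>v. X = ?f v \<and> (\<exists>x y. v = x *\<^sub>R b 1 + y *\<^sub>R b 2))"
      using b unfolding ordered_bases_2_iff by blast
    also have "\<dots> \<longleftrightarrow> (\<exists>x y. X = x *\<^sub>R ?f (b 1) + y *\<^sub>R ?f (b 2))"
      using comb by metis
    finally show ?thesis .
  qed
  moreover have "x = 0 \<and> y = 0" if "x *\<^sub>R ?f (b 1) + y *\<^sub>R ?f (b 2) = 0" for x y
  proof -
    have "x *\<^sub>R b 1 + y *\<^sub>R b 2 = 0"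
      by (rule inj) (simp only: comb that linear_0[OF lin])
    then show ?thesis using b unfolding ordered_bases_2_iff by blast
  qed
  ultimately have "(\<lambda>i. ?f (b i)) \<in> ordered_bases (V p)"
    unfolding ordered_bases_2_iff by blast
  then show thesis by (rule that)
qed

abbreviation Pr :: "('a, real^4) endo_field" where
  "Pr q \<equiv> para_hypercomplex_space.P (J2 q) s"

abbreviation Kr :: "('a, real^4) endo_field" where
  "Kr q \<equiv> para_hypercomplex_space.K (J1 q) (J2 q) s"

lemma smooth_vector_field_on_Pr:
  assumes U: "open U" "U \<subseteq> M" and X: "smooth_vector_field_on A U X"
  shows "smooth_vector_field_on A U (\<lambda>q. Pr q (X q))"
proof -
  have "smooth_vector_field_on A U (\<lambda>q. (1/2) *\<^sub>R X q + (s/2) *\<^sub>R J2 q (X q))"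
    using smooth_vector_field_on_endomorphism[OF smooth_J(2) U X] X
    by (intro smooth_vector_field_on_add[OF U(1)] smooth_vector_field_on_scaleR[OF U(1)])
  moreover have "(1/2) *\<^sub>R X q + (s/2) *\<^sub>R J2 q (X q) = Pr q (X q)" if "q \<in> U" for q
    by (rule para_hypercomplex_space.P_def[OF para_hypercomplex_tangent_space, symmetric]) (use U that in blast)
  ultimately show ?thesis
    by (rule smooth_vector_field_on_cong[OF U(1), THEN iffD1, rotated])
qed

lemma smooth_vector_field_on_Kr:
  assumes U: "open U" "U \<subseteq> M" and X: "smooth_vector_field_on A U X"
  shows "smooth_vector_field_on A U (\<lambda>q. Kr q (X q))"
proof -
  have "smooth_vector_field_on A U (\<lambda>q. (s/2) *\<^sub>R J1 q (J2 q (X q)) + (-1/2) *\<^sub>R J1 q (X q))"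
    using smooth_vector_field_on_endomorphism[OF smooth_J(1) U]
      smooth_vector_field_on_endomorphism[OF smooth_J(2) U X] X
    by (intro smooth_vector_field_on_add[OF U(1)] smooth_vector_field_on_scaleR[OF U(1)])
  moreover have "(s/2) *\<^sub>R J1 q (J2 q (X q)) + (-1/2) *\<^sub>R J1 q (X q) = Kr q (X q)" if "q \<in> U" for q
    by (rule para_hypercomplex_space.K_def[OF para_hypercomplex_tangent_space, symmetric]) (use U that in blast)
  ultimately show ?thesis
    by (rule smooth_vector_field_on_cong[OF U(1), THEN iffD1, rotated])
qed

abbreviation compatible_at :: "'a \<Rightarrow> ((('a, real^4) chart \<Rightarrow> real^4) \<Rightarrow> (('a, real^4) chart \<Rightarrow> real^4) \<Rightarrow> real) \<Rightarrow> bool" where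
  "compatible_at p \<equiv> compatible_form (T p) (J1 p) (J2 p)"

text \<open>Smoothness of a form is a statement about coordinate fields. Expanding \<open>X\<close>
  and \<open>Y\<close> in them gives finite sums of smooth products; compatibility supplies the
  bilinearity.\<close>

lemma smooth_form_on_apply:
  assumes U: "open U" "U \<subseteq> M" and g: "smooth_form_on A U g" "\<And>q. q \<in> U \<Longrightarrow> compatible_at q (g q)"
    and X: "smooth_vector_field_on A U X" and Y: "smooth_vector_field_on A U Y"
  shows "smooth_fun_on A U (\<lambda>q. g q (X q) (Y q))"
proof (rule smooth_fun_on_locally[OF U(1)])
  fix p assume "p \<in> U"
  then obtain c where c: "c \<in> A" "p \<in> chart_dom c" using U(2) carrierE by blast
  let ?W = "U \<inter> chart_dom c" and ?e = "chart_vector A c"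
  have W: "open ?W" using U c open_chart_dom by blast
  have "smooth_fun_on A ?W (\<lambda>q. \<Sum>u\<in>Basis. (X q c \<bullet> u) * (\<Sum>v\<in>Basis. (Y q c \<bullet> v) * g q (?e u q) (?e v q)))"
    by (intro smooth_fun_on_sum[OF W] smooth_fun_on_mult[OF W] smooth_fun_on_inner[OF W]
      smooth_vector_field_on_coord[OF U(1) _ c(1)] X Y smooth_form_onD[OF g(1) c(1)])
  then have "smooth_fun_on A ?W (\<lambda>q. g q (X q) (Y q))"
  proof (rule smooth_fun_on_cong[OF W, THEN iffD1, rotated])
    fix q assume q: "q \<in> ?W"
    then have qM: "q \<in> M" using U by blast
    interpret tangent: para_hypercomplex_space "T q" "J1 q" "J2 q" s
      by (rule para_hypercomplex_tangent_space[OF qM])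
    have gq: "compatible_at q (g q)" using g(2) q by blast
    have e: "?e u q \<in> T q" for u using chart_vector_tangent c(1) q by blast
    have XY: "X q \<in> T q" "Y q \<in> T q" using smooth_vector_field_on_tangent X Y q by blast+
    have "g q (X q) (Y q) = g q (\<Sum>u\<in>Basis. (X q c \<bullet> u) *\<^sub>R ?e u q) (Y q)"
      by (rule arg_cong[OF tangent_expansion[OF XY(1) c(1) IntD2[OF q]], of "\<lambda>Z. g q Z (Y q)"])
    also have "\<dots> = (\<Sum>u\<in>Basis. (X q c \<bullet> u) * g q (?e u q) (Y q))"
      by (rule tangent.form_sum_left[OF gq finite_Basis e XY(2)])
    also have "\<dots> = (\<Sum>u\<in>Basis. (X q c \<bullet> u) * (\<Sum>v\<in>Basis. (Y q c \<bullet> v) * g q (?e u q) (?e v q)))"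
    proof (rule sum.cong[OF refl])
      fix u :: "real^4"
      have "g q (?e u q) (Y q) = g q (?e u q) (\<Sum>v\<in>Basis. (Y q c \<bullet> v) *\<^sub>R ?e v q)"
        by (rule arg_cong[OF tangent_expansion[OF XY(2) c(1) IntD2[OF q]]])
      also have "\<dots> = (\<Sum>v\<in>Basis. (Y q c \<bullet> v) * g q (?e u q) (?e v q))"
        by (rule tangent.form_sum_right[OF gq finite_Basis e e])
      finally show "(X q c \<bullet> u) * g q (?e u q) (Y q) =
          (X q c \<bullet> u) * (\<Sum>v\<in>Basis. (Y q c \<bullet> v) * g q (?e u q) (?e v q))" by (rule arg_cong)
    qed
    finally show "(\<Sum>u\<in>Basis. (X q c \<bullet> u) * (\<Sum>v\<in>Basis. (Y q c \<bullet> v) * g q (?e u q) (?e v q))) =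
      g q (X q) (Y q)" by (rule sym)
  qed
  then show "\<exists>W. open W \<and> p \<in> W \<and> smooth_fun_on A (U \<inter> W) (\<lambda>q. g q (X q) (Y q))"
    using c open_chart_dom by blast
qed

lemma V_eq: "V p = {X \<in> T p. J2 p X = s *\<^sub>R X}"
  by (simp add: eigenbundle_def)

lemma alternating_form_V:
  "p \<in> M \<Longrightarrow> compatible_at p g \<Longrightarrow> alternating_form (V p) (\<lambda>X Y. g X (J1 p Y))"
  unfolding V_eq
  using para_hypercomplex_space.alternating_form_of_compatible[OF para_hypercomplex_tangent_space] .

section \<open>From a metric to an orientation\<close>

lemma compatible_at_of_metric:
  assumes g: "pseudo_riemannian_metric A g" "compatible_metric A J1 J2 J3 g" and p: "p \<in> M"
  shows "compatible_at p (g p)"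
proof -
  note metric = g(1)[unfolded pseudo_riemannian_metric_def, THEN conjunct1, THEN bspec, OF p]
  note compatible = g(2)[unfolded compatible_metric_def, THEN bspec, OF p]
  show ?thesis
    unfolding compatible_form_def
  proof (intro conjI ballI allI)
    fix X Y r assume XY: "X \<in> T p" "Y \<in> T p"
    show "g p (X + Y) Z = g p X Z + g p Y Z" if "Z \<in> T p" for Z using metric[THEN conjunct1] XY that by blast
    show "g p (r *\<^sub>R X) Y = r * g p X Y" using metric[THEN conjunct2, THEN conjunct1] XY by blast
    show "g p X Y = g p Y X" using metric[THEN conjunct2, THEN conjunct2, THEN conjunct1, THEN bspec, THEN bspec, OF XY] .
    show "g p (J1 p X) (J1 p Y) = g p X Y" using compatible[THEN bspec, THEN bspec, OF XY] by (rule conjunct1)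
    show "g p (J2 p X) (J2 p Y) = - g p X Y" using compatible[THEN bspec, THEN bspec, OF XY] by linarith
  qed
qed

lemma orientable_if_metric:
  assumes g: "pseudo_riemannian_metric A g" "compatible_metric A J1 J2 J3 g"
  shows "orientable_subbundle TYPE(2) A V"
proof -
  note comp = compatible_at_of_metric[OF g]
  have smooth_g: "smooth_form_on A M g"
    unfolding smooth_form_on_carrier_iff
    using g(1)[unfolded pseudo_riemannian_metric_def] by (rule conjunct2)
  \<comment> \<open>The bases on which \<open>w\<close> is positive; by
    \<open>same_orientation_iff\<close> they make up a single class as soon as there is one.\<close>
  define ori where "ori p = {b :: 2 \<Rightarrow> _. b \<in> ordered_bases (V p) \<and> g p (b 1) (J1 p (b 2)) > 0}" for p
  have pos_basis: "\<exists>b. b \<in> ori p" if p: "p \<in> M" for p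
  proof -
    obtain b :: "2 \<Rightarrow> _" where b: "b \<in> ordered_bases (V p)" using V_basis_exists[OF p] .
    have nz: "g p (b 1) (J1 p (b 2)) \<noteq> 0"
    proof (rule para_hypercomplex_space.nondegenerate_imp_nonzero[OF para_hypercomplex_tangent_space[OF p]
          comp[OF p] b[unfolded V_eq]])
      fix X assume "X \<in> T p" "\<And>Y. Y \<in> T p \<Longrightarrow> g p X Y = 0"
      then show "X = 0"
        using g(1)[unfolded pseudo_riemannian_metric_def, THEN conjunct1, THEN bspec, OF p,
          THEN conjunct2, THEN conjunct2, THEN conjunct2] by blast
    qed
    note alt = alternating_form_V[OF p comp[OF p]]
    \<comment> \<open>If \<open>w\<close> is negative on \<open>b\<close>, exchanging the two
      vectors makes it positive.\<close>
    let ?b = "\<lambda>i::2. if i = 1 then b 2 else b 1"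
    have mem: "b i \<in> V p" for i using ordered_bases_2_mem[OF b] .
    have swap: "g p (b 2) (J1 p (b 1)) = - g p (b 1) (J1 p (b 2))"
      using alternating_form_swap[OF alt mem mem] .
    have "?b \<in> ordered_bases (V p)"
      by (rule ordered_bases_2_of_alternating_form[OF alt b]) (use mem nz swap in auto)
    then show ?thesis
      using b nz swap unfolding ori_def
      by (cases "g p (b 1) (J1 p (b 2)) > 0") (auto intro: exI[of _ ?b])
  qed
  have "ori p \<in> orientations (V p)" if p: "p \<in> M" for p
  proof -
    obtain b where b: "b \<in> ori p" using pos_basis[OF p] by blast
    then have "ori p = same_orientation (V p) `` {b}"
      using same_orientation_iff[OF alternating_form_V[OF p comp[OF p]], of b] unfolding ori_def by blast
    then show ?thesis
      using b unfolding orientations_def ori_def by (auto intro: quotientI)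
  qed
  moreover have "\<exists>U b. open U \<and> p \<in> U \<and> U \<subseteq> M \<and>
      (\<forall>i. smooth_vector_field_on A U (\<lambda>q. b q i)) \<and> (\<forall>q\<in>U. b q \<in> ori q)" if p: "p \<in> M" for p
  proof -
    obtain b where b: "b \<in> ori p" using pos_basis[OF p] by blast
    obtain c where c: "c \<in> A" "p \<in> chart_dom c" using p carrierE by blast
    have dom: "open (chart_dom c)" "chart_dom c \<subseteq> M" using c open_chart_dom carrierI by blast+
    \<comment> \<open>The vectors of \<open>b\<close> are extended with constant coordinates and
      projected to \<open>V\<close>. At \<open>p\<close> the projection changes nothing, so
      \<open>w\<close> is positive there and hence nearby, and a positive value already makes
      \<open>X q\<close> a basis of the fibre.\<close>
    define X where "X q i = Pr q (chart_vector A c (b i c) q)" for q i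
    have X: "smooth_vector_field_on A (chart_dom c) (\<lambda>q. X q i)" for i
      unfolding X_def by (rule smooth_vector_field_on_Pr[OF dom smooth_vector_field_on_chart_vector[OF c(1)]])
    have X_V: "X q i \<in> V q" if "q \<in> chart_dom c" for q i
      unfolding X_def V_eq
      by (rule para_hypercomplex_space.P_mem[OF para_hypercomplex_tangent_space chart_vector_tangent])
        (use that c dom in auto)
    have "X p i = b i" for i
    proof -
      have bi: "b i \<in> V p" using b ordered_bases_2_mem unfolding ori_def by blast
      then have "b i = chart_vector A c (b i c) p"
        using tangent_eq_chart_vector c unfolding V_eq by blast
      then show ?thesis
        unfolding X_def
        using para_hypercomplex_space.P_eq[OF para_hypercomplex_tangent_space[OF p] bi[unfolded V_eq]] by metis
    qed
    then have Xp: "X p = b" by blast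
    let ?f = "\<lambda>q. g q (X q 1) (J1 q (X q 2))"
    have f: "smooth_fun_on A (chart_dom c) ?f"
      by (rule smooth_form_on_apply[OF dom smooth_form_on_subset[OF smooth_g dom(2)] _ X
        smooth_vector_field_on_endomorphism[OF smooth_J(1) dom X]]) (use comp dom in blast)
    define U where "U = {q \<in> chart_dom c. ?f q > 0}"
    have U: "open U" unfolding U_def by (rule open_superlevel[OF dom f])
    have "X q \<in> ori q" if "q \<in> U" for q
    proof -
      have q: "q \<in> chart_dom c" "?f q > 0" using that unfolding U_def by blast+
      then have qM: "q \<in> M" using dom by blast
      obtain b' :: "2 \<Rightarrow> _" where b': "b' \<in> ordered_bases (V q)" using V_basis_exists[OF qM] .
      have "X q \<in> ordered_bases (V q)"
        by (rule ordered_bases_2_of_alternating_form[OF alternating_form_V[OF qM comp[OF qM]] b'])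
          (use X_V[OF q(1)] q(2) in auto)
      then show ?thesis using q(2) unfolding ori_def by blast
    qed
    moreover have "p \<in> U" using b c by (simp add: U_def ori_def Xp)
    moreover have "smooth_vector_field_on A U (\<lambda>q. X q i)" for i
      by (rule smooth_vector_field_on_subset[OF X]) (auto simp: U_def)
    moreover have "U \<subseteq> M" using dom unfolding U_def by blast
    ultimately show ?thesis using U by blast
  qed
  ultimately show ?thesis
    unfolding orientable_subbundle_def by blast
qed

section \<open>From an orientation to a metric\<close>

lemma local_positive_form:
  fixes b :: "'a \<Rightarrow> 2 \<Rightarrow> ('a, real^4) chart \<Rightarrow> real^4"
  assumes U: "open U" "p \<in> U" "U \<subseteq> M"
    and smooth_b: "\<And>i. smooth_vector_field_on A U (\<lambda>q. b q i)"
    and basis: "\<And>q. q \<in> U \<Longrightarrow> b q \<in> ordered_bases (V q)"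
  shows "\<exists>W g. open W \<and> p \<in> W \<and> W \<subseteq> U \<and> smooth_form_on A W g \<and>
    (\<forall>q\<in>W. compatible_at q (g q) \<and> g q (b q 1) (J1 q (b q 2)) > 0)"
proof -
  obtain c where c: "c \<in> A" "p \<in> chart_dom c" using U carrierE by blast
  define W where "W = U \<inter> chart_dom c"
  have W: "open W" "p \<in> W" "W \<subseteq> U" "W \<subseteq> M"
    using U c open_chart_dom unfolding W_def by blast+
  \<comment> \<open>The coordinates are those of the single chart \<open>c\<close>, hence the
    restriction to \<open>W\<close>. Fixing the last two rows as \<open>J1 b\<close> makes the
    determinant an alternating form on \<open>V\<close> that does not vanish on
    \<open>b\<close>.\<close>
  define vol where "vol q X Y = vol4 (X c) (Y c) (J1 q (b q 1) c) (J1 q (b q 2) c)" for q and X Y :: "('a, real^4) chart \<Rightarrow> real^4"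
  define w where "w q X Y = vol q X Y * vol q (b q 1) (b q 2)" for q and X Y :: "('a, real^4) chart \<Rightarrow> real^4"
  define g where "g q = para_hypercomplex_space.form_of (J1 q) (J2 q) s (w q)" for q
  have smooth_vol: "smooth_fun_on A S (\<lambda>q. vol q (X q) (Y q))"
    if S: "open S" "S \<subseteq> W" and X: "smooth_vector_field_on A S X" and Y: "smooth_vector_field_on A S Y" for S X Y
  proof -
    have Sc: "S \<inter> chart_dom c = S" using S(2) unfolding W_def by blast
    have SM: "S \<subseteq> M" using S(2) W(4) by blast
    have bS: "smooth_vector_field_on A S (\<lambda>q. b q i)" for i
      using smooth_vector_field_on_subset[OF smooth_b] S(2) W(3) by blast
    note coord = smooth_vector_field_on_coord[OF S(1) _ c(1), unfolded Sc]
    show ?thesis unfolding vol_def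
      by (rule smooth_fun_on_vol4[OF S(1) coord[OF X] coord[OF Y]
        coord[OF smooth_vector_field_on_endomorphism[OF smooth_J(1) S(1) SM bS]]
        coord[OF smooth_vector_field_on_endomorphism[OF smooth_J(1) S(1) SM bS]]])
  qed
  have alt: "alternating_form (V q) (w q)" for q
  proof -
    have add: "vol q (X + Y) Z = vol q X Z + vol q Y Z" and scale: "vol q (r *\<^sub>R X) Y = r * vol q X Y"
      and swap: "vol q Y X = - vol q X Y" for X Y Z r
      unfolding vol_def plus_fun_apply scaleR_fun_apply
      by (rule vol4_add, rule vol4_scale, rule vol4_swap)
    show ?thesis
      unfolding alternating_form_def w_def
    proof (intro conjI ballI allI)
      fix X Y r
      show "vol q (X + Y) Z * vol q (b q 1) (b q 2) =
          vol q X Z * vol q (b q 1) (b q 2) + vol q Y Z * vol q (b q 1) (b q 2)" for Z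
        unfolding add by (rule distrib_right)
      show "vol q (r *\<^sub>R X) Y * vol q (b q 1) (b q 2) = r * (vol q X Y * vol q (b q 1) (b q 2))"
        unfolding scale by (rule mult.assoc)
      show "vol q Y X * vol q (b q 1) (b q 2) = - (vol q X Y * vol q (b q 1) (b q 2))"
        unfolding swap[of Y X] by (rule mult_minus_left)
    qed
  qed
  have pos: "w q (b q 1) (b q 2) > 0" if q: "q \<in> W" for q
  proof -
    have qM: "q \<in> M" and qc: "q \<in> chart_dom c" using W q unfolding W_def by blast+
    interpret tangent: para_hypercomplex_space "T q" "J1 q" "J2 q" s
      by (rule para_hypercomplex_tangent_space[OF qM])
    have bq: "b q \<in> ordered_bases (V q)" using basis q W by blast
    have bT: "b q i \<in> T q" for i using ordered_bases_2_mem[OF bq, of i] unfolding V_eq by blast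
    let ?S = "{b q 1 c, b q 2 c, J1 q (b q 1) c, J1 q (b q 2) c}"
    \<comment> \<open>The tangent vector with coordinates \<open>v\<close> is
      \<open>P + J1 K\<close> of itself, and both components are combinations of
      \<open>b\<close>.\<close>
    have "v \<in> span ?S" for v
    proof -
      let ?X = "chart_vector A c v q"
      have X: "?X \<in> T q" by (rule chart_vector_tangent[OF c(1) qc])
      obtain x y where xy: "Pr q ?X = x *\<^sub>R b q 1 + y *\<^sub>R b q 2"
        using ordered_bases_2_expansion[OF bq] tangent.P_mem[OF X] unfolding V_eq by blast
      obtain z t where zt: "Kr q ?X = z *\<^sub>R b q 1 + t *\<^sub>R b q 2"
        using ordered_bases_2_expansion[OF bq] tangent.K_mem[OF X] unfolding V_eq by blast
      have J1K: "J1 q (Kr q ?X) = z *\<^sub>R J1 q (b q 1) + t *\<^sub>R J1 q (b q 2)"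
        unfolding zt tangent.J1_add[OF tangent.T_scale[OF bT] tangent.T_scale[OF bT]]
          tangent.J1_scale[OF bT] by (rule refl)
      have "?X = x *\<^sub>R b q 1 + y *\<^sub>R b q 2 + (z *\<^sub>R J1 q (b q 1) + t *\<^sub>R J1 q (b q 2))"
        using tangent.decomposition[OF X] unfolding xy J1K .
      then have "?X c = x *\<^sub>R b q 1 c + y *\<^sub>R b q 2 c + (z *\<^sub>R J1 q (b q 1) c + t *\<^sub>R J1 q (b q 2) c)"
        by (rule trans[OF fun_cong[of _ _ c]]) (simp only: plus_fun_apply scaleR_fun_apply)
      then have "v = x *\<^sub>R b q 1 c + y *\<^sub>R b q 2 c + (z *\<^sub>R J1 q (b q 1) c + t *\<^sub>R J1 q (b q 2) c)"
        unfolding chart_vector_same[OF c(1) qc] .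
      moreover have "\<dots> \<in> span ?S"
        by (intro span_add span_scale span_base) simp_all
      ultimately show ?thesis by (rule ssubst)
    qed
    then have "vol q (b q 1) (b q 2) \<noteq> 0"
      unfolding vol_def by (intro vol4_nonzero) blast
    then show ?thesis unfolding w_def by (auto simp: zero_less_mult_iff)
  qed
  have smooth_g: "smooth_form_on A W g"
  proof (rule smooth_form_onI)
    fix d and u v :: "real^4" assume d: "d \<in> A"
    let ?S = "W \<inter> chart_dom d"
    have S: "open ?S" "?S \<subseteq> W" "?S \<subseteq> M" "?S \<subseteq> chart_dom d" using W d open_chart_dom by blast+
    have e: "smooth_vector_field_on A ?S (chart_vector A d u)" for u
      using smooth_vector_field_on_subset[OF smooth_vector_field_on_chart_vector[OF d] S(4)] .
    note Pe = smooth_vector_field_on_Pr[OF S(1,3) e] and Ke = smooth_vector_field_on_Kr[OF S(1,3) e]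
    have b: "smooth_vector_field_on A ?S (\<lambda>q. b q i)" for i
      using smooth_vector_field_on_subset[OF smooth_b] S(2) W(3) by blast
    have w: "smooth_fun_on A ?S (\<lambda>q. w q (X q) (Y q))"
      if "smooth_vector_field_on A ?S X" "smooth_vector_field_on A ?S Y" for X Y
      unfolding w_def by (rule smooth_fun_on_mult[OF S(1) smooth_vol[OF S(1,2) that] smooth_vol[OF S(1,2) b b]])
    have "smooth_fun_on A ?S (\<lambda>q. w q (Pr q (chart_vector A d u q)) (Kr q (chart_vector A d v q)) +
        w q (Pr q (chart_vector A d v q)) (Kr q (chart_vector A d u q)))"
      by (rule smooth_fun_on_add[OF S(1) w[OF Pe Ke] w[OF Pe Ke]])
    moreover have "w q (Pr q (chart_vector A d u q)) (Kr q (chart_vector A d v q)) +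
        w q (Pr q (chart_vector A d v q)) (Kr q (chart_vector A d u q)) =
        g q (chart_vector A d u q) (chart_vector A d v q)" if "q \<in> ?S" for q
      unfolding g_def
      by (rule para_hypercomplex_space.form_of_def[OF para_hypercomplex_tangent_space, symmetric]) (use that S in blast)
    ultimately show "smooth_fun_on A ?S (\<lambda>q. g q (chart_vector A d u q) (chart_vector A d v q))"
      by (rule smooth_fun_on_cong[OF S(1), THEN iffD1, rotated])
  qed
  have comp: "compatible_at q (g q)" if "q \<in> W" for q
    unfolding g_def
    by (rule para_hypercomplex_space.compatible_form_form_of[OF para_hypercomplex_tangent_space alt[unfolded V_eq]])
      (use that W in blast)
  have "g q (b q 1) (J1 q (b q 2)) > 0" if q: "q \<in> W" for q
  proof -
    have qM: "q \<in> M" using W q by blast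
    have bV: "b q i \<in> V q" for i using ordered_bases_2_mem[OF basis] q W by blast
    have "g q (b q 1) (J1 q (b q 2)) = w q (b q 1) (b q 2)"
      unfolding g_def
      by (rule para_hypercomplex_space.form_of_J1[OF para_hypercomplex_tangent_space[OF qM]
        alt[unfolded V_eq] bV[unfolded V_eq] bV[unfolded V_eq]])
    then show ?thesis using pos[OF q] by linarith
  qed
  then show ?thesis using W(1-3) smooth_g comp by blast
qed

lemma metric_if_orientable:
  assumes "orientable_subbundle TYPE(2) A V"
  obtains g where "pseudo_riemannian_metric A g" "compatible_metric A J1 J2 J3 g"
proof -
  obtain ori :: "'a \<Rightarrow> (2 \<Rightarrow> ('a, real^4) chart \<Rightarrow> real^4) set" where
    *: "(\<forall>p\<in>M. ori p \<in> orientations (V p)) \<and>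
      (\<forall>p\<in>M. \<exists>U b. open U \<and> p \<in> U \<and> U \<subseteq> M \<and>
        (\<forall>i. smooth_vector_field_on A U (\<lambda>q. b q i)) \<and> (\<forall>q\<in>U. b q \<in> ori q))"
    using assms unfolding orientable_subbundle_def by (rule exE)
  note ori = *[THEN conjunct1, THEN bspec] and frames = *[THEN conjunct2, THEN bspec]
  \<comment> \<open>Positivity is demanded on every basis in \<open>ori q\<close>, not only on a
    local frame, so that forms built from different frames can be added. \<open>F\<close> already
    contains the cut-off: it may vanish, but not where \<open>u > 0\<close>.\<close>
  define good where "good u F \<longleftrightarrow> smooth_fun_on A M u \<and> smooth_form_on A M F \<and> (\<forall>q\<in>M. u q \<ge> 0 \<and>
      compatible_at q (F q) \<and> (\<forall>b\<in>ori q. F q (b 1) (J1 q (b 2)) \<ge> 0 \<and> (u q > 0 \<longrightarrow> F q (b 1) (J1 q (b 2)) > 0)))"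
    for u :: "'a \<Rightarrow> real" and F
  have local: "\<exists>u F. good u F \<and> u p > 1" if p: "p \<in> M" for p
  proof -
    obtain U b where U: "open U" "p \<in> U" "U \<subseteq> M"
      and b: "\<And>i. smooth_vector_field_on A U (\<lambda>q. b q i)" "\<And>q. q \<in> U \<Longrightarrow> b q \<in> ori q"
      using frames[OF p] by blast
    have basis: "b q \<in> ordered_bases (V q)" if "q \<in> U" for q
      by (rule orientation_mem_ordered_bases[OF ori b(2)[OF that]]) (use U that in blast)
    have "\<exists>W g. open W \<and> p \<in> W \<and> W \<subseteq> U \<and> smooth_form_on A W g \<and>
        (\<forall>q\<in>W. compatible_at q (g q) \<and> g q (b q 1) (J1 q (b q 2)) > 0)"
      by (rule local_positive_form[OF U b(1) basis])
    then obtain W g where W: "open W" "p \<in> W" "W \<subseteq> U" and smooth_g: "smooth_form_on A W g"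
      and g: "\<forall>q\<in>W. compatible_at q (g q) \<and> g q (b q 1) (J1 q (b q 2)) > 0"
      by (elim exE conjE)
    note comp_g = g[THEN bspec, THEN conjunct1] and pos_g = g[THEN bspec, THEN conjunct2]
    obtain u K where u: "smooth_fun_on A M u" "\<forall>q. u q \<ge> (0::real)" "u p > 1"
      and K: "closed K" "K \<subseteq> W" "\<forall>q. q \<notin> K \<longrightarrow> u q = 0"
      using smooth_bump[OF W(1,2) p] by (elim exE conjE)
    \<comment> \<open>Nothing is known about \<open>g\<close> off \<open>W\<close>, but
      \<open>u\<close> vanishes off the closed set \<open>K\<close> inside \<open>W\<close>, so the
      product is smooth and compatible everywhere.\<close>
    define F where "F q X Y = u q * g q X Y" for q X Y
    have F0: "F q X Y = 0" if "q \<notin> K" for q X Y unfolding F_def using K(3) that by simp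
    have WM: "W \<subseteq> M" using W U by blast
    have "smooth_form_on A M F"
    proof (rule smooth_form_on_locally[OF open_carrier])
      fix q assume "q \<in> M"
      show "\<exists>S. open S \<and> q \<in> S \<and> smooth_form_on A (M \<inter> S) F"
      proof (cases "q \<in> K")
        case True
        have "smooth_form_on A W F"
          unfolding F_def by (rule smooth_form_on_mult[OF W(1) smooth_fun_on_subset[OF u(1) WM] smooth_g])
        moreover have "M \<inter> W = W" using WM by blast
        ultimately show ?thesis using True K(2) W(1) by (intro exI[of _ W]) auto
      next
        case False
        have MK: "open (M \<inter> - K)" using open_carrier K(1) by (simp add: open_Int open_Compl)
        have "smooth_form_on A (M \<inter> - K) F"
          by (rule smooth_form_on_cong[OF MK _ smooth_form_on_zero[OF MK]]) (simp add: F0)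
        then show ?thesis using False K(1) by (intro exI[of _ "- K"]) auto
      qed
    qed
    moreover have "compatible_at q (F q)" for q
    proof (cases "q \<in> K")
      case True
      then have "compatible_at q (\<lambda>X Y. u q * g q X Y)"
        using compatible_form_mult[OF comp_g] K(2) by blast
      then show ?thesis unfolding F_def .
    next
      case False
      then have "F q = (\<lambda>X Y. 0)" using F0 by blast
      then show ?thesis using compatible_form_zero by metis
    qed
    moreover have "F q (b' 1) (J1 q (b' 2)) \<ge> 0 \<and> (u q > 0 \<longrightarrow> F q (b' 1) (J1 q (b' 2)) > 0)"
      if q: "q \<in> M" and b': "b' \<in> ori q" for q b'
    proof (cases "q \<in> K")
      case True
      then have qW: "q \<in> W" "q \<in> U" using K(2) W(3) by blast+
      have "g q (b' 1) (J1 q (b' 2)) > 0"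
        using orientation_alternating_form_pos[OF ori[OF q] b(2)[OF qW(2)] b' alternating_form_V[OF q comp_g[OF qW(1)]]]
          pos_g[OF qW(1)] by blast
      then show ?thesis unfolding F_def using u(2)[THEN spec, of q] by simp
    next
      case False
      then show ?thesis using F0 K(3) by simp
    qed
    ultimately have "good u F" unfolding good_def using u(1,2) by blast
    then show ?thesis using u(3) by blast
  qed
  \<comment> \<open>Keeps the countable family non-empty, so that it can be enumerated even if the
    subcover is empty.\<close>
  have trivial: "good (\<lambda>q. 0) (\<lambda>q X Y. 0)"
    unfolding good_def
    by (simp add: smooth_fun_on_const open_carrier smooth_form_on_zero compatible_form_zero)
  define S where "S = {(u, F). good u F}"
  \<comment> \<open>The sets \<open>u > 1\<close> cover \<open>M\<close>, and second countability
    reduces them to countably many. Positivity of \<open>F\<close> holds on the larger set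
    \<open>u > 0\<close>; the gap between the two thresholds leaves room for smooth weights that do
    not destroy it.\<close>
  define N where "N u = {q \<in> M. (u :: 'a \<Rightarrow> real) q > 1}" for u
  have openN: "open (N u)" if "good u F" for u F
    unfolding N_def by (rule open_superlevel[OF open_carrier order_refl]) (use that good_def in blast)
  have "\<And>X. X \<in> (N \<circ> fst) ` S \<Longrightarrow> open X"
    unfolding S_def using openN by auto
  then obtain \<F> where \<F>: "\<F> \<subseteq> (N \<circ> fst) ` S" "countable \<F>" "\<Union>\<F> = \<Union>((N \<circ> fst) ` S)"
    using Lindelof[of "(N \<circ> fst) ` S"] by metis
  then obtain C where C: "C \<subseteq> S" "countable C" "\<F> = (N \<circ> fst) ` C"
    using countable_subset_image[of \<F> "N \<circ> fst" S] by metis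
  define C' where "C' = insert ((\<lambda>q. 0), (\<lambda>q X Y. 0)) C"
  have C': "C' \<noteq> {}" "countable C'" "C' \<subseteq> S"
    unfolding C'_def using C trivial by (auto simp: S_def)
  define u where "u i = fst (from_nat_into C' i)" for i
  define F where "F i = snd (from_nat_into C' i)" for i
  have "good (u i) (F i)" for i
    using from_nat_into[OF C'(1), of i] C'(3) unfolding u_def F_def S_def by auto
  then have u: "smooth_fun_on A M (u i)" and F: "smooth_form_on A M (F i)"
    and pt: "q \<in> M \<Longrightarrow> u i q \<ge> 0" "q \<in> M \<Longrightarrow> compatible_at q (F i q)"
      "q \<in> M \<Longrightarrow> b \<in> ori q \<Longrightarrow> F i q (b 1) (J1 q (b 2)) \<ge> 0"
      "q \<in> M \<Longrightarrow> b \<in> ori q \<Longrightarrow> u i q > 0 \<Longrightarrow> F i q (b 1) (J1 q (b 2)) > 0" for i q b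
    unfolding good_def by blast+
  have cover: "\<exists>i. u i q > 1" if q: "q \<in> M" for q
  proof -
    obtain u0 F0 where "good u0 F0" "u0 q > 1" using local[OF q] by blast
    then have "q \<in> \<Union>((N \<circ> fst) ` S)" using q unfolding S_def N_def by force
    then have "q \<in> \<Union>((N \<circ> fst) ` C)" unfolding \<F>(3)[symmetric] C(3) .
    then obtain z where z: "z \<in> C" "q \<in> N (fst z)" by auto
    then have "z \<in> C'" unfolding C'_def by blast
    then obtain i where "from_nat_into C' i = z"
      using from_nat_into_surj[OF C'(2)] by blast
    then show ?thesis using z(2) unfolding u_def N_def by blast
  qed
  \<comment> \<open>\<open>r i\<close> vanishes on \<open>{u j > 1}\<close> for \<open>j < i\<close>, so the sum of the \<open>r i * F i\<close> is locally finite.\<close>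
  define r where "r i q = (\<Prod>j<i. flat_exp 0 (1 + - u j q))" for i q
  \<comment> \<open>The weights \<open>r i\<close> with \<open>i > n q\<close> vanish at
    \<open>q\<close>, so stopping at \<open>n q\<close> loses nothing.\<close>
  define n where "n q = (LEAST i. u i q > 1)" for q
  define g where "g q X Y = (\<Sum>i\<le>n q. r i q * F i q X Y)" for q X Y
  have r0: "r i q = 0" if "u j q > 1" "j < i" for i j q
    unfolding r_def using that by (intro prod_zero bexI[of _ j]) (auto simp: flat_exp_def)
  have r_nonneg: "r i q \<ge> 0" for i q
    unfolding r_def using flat_exp_nonneg by (intro prod_nonneg) blast
  have smooth_r: "smooth_fun_on A M (r i)" for i
  proof -
    have "smooth_fun_on A M (\<lambda>q. 1 + - u j q)" for j
      by (rule smooth_fun_on_add[OF open_carrier smooth_fun_on_const[OF open_carrier]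
        smooth_fun_on_bounded_linear[OF bounded_linear_minus[OF bounded_linear_ident] open_carrier u]])
    then show ?thesis unfolding r_def
      by (rule smooth_fun_on_prod[OF open_carrier smooth_fun_on_compose[OF open_carrier smooth_on_flat_exp]])
  qed
  \<comment> \<open>The bound \<open>n q\<close> may jump as \<open>q\<close> varies. On the open
    set \<open>u m > 1\<close> the constant bound \<open>m\<close> gives the same sum, whence
    smoothness of \<open>g\<close>.\<close>
  have g_eq: "g q X Y = (\<Sum>i\<le>m. r i q * F i q X Y)" if "u m q > 1" for m q X Y
  proof -
    have "n q \<le> m" "u (n q) q > 1" unfolding n_def using that by (auto intro: Least_le LeastI)
    then show ?thesis unfolding g_def using r0 by (intro sum.mono_neutral_left) auto
  qed
  have smooth_g: "smooth_form_on A M g"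
  proof (rule smooth_form_on_locally[OF open_carrier])
    fix q assume q: "q \<in> M"
    obtain m where m: "u m q > 1" using cover[OF q] by blast
    have Nm: "open (N (u m))" "N (u m) \<subseteq> M"
      using openN \<open>\<And>i. good (u i) (F i)\<close> unfolding N_def by blast+
    have "smooth_form_on A (N (u m)) (\<lambda>q X Y. \<Sum>i\<le>m. r i q * F i q X Y)"
      by (rule smooth_form_on_sum[OF Nm(1) smooth_form_on_mult[OF Nm(1)
        smooth_fun_on_subset[OF smooth_r Nm(2)] smooth_form_on_subset[OF F Nm(2)]]])
    then have "smooth_form_on A (N (u m)) g"
      by (rule smooth_form_on_cong[OF Nm(1), rotated]) (simp add: N_def g_eq[of m])
    moreover have "M \<inter> N (u m) = N (u m)" using Nm(2) by blast
    ultimately show "\<exists>W. open W \<and> q \<in> W \<and> smooth_form_on A (M \<inter> W) g"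
      using Nm(1) q m by (intro exI[of _ "N (u m)"]) (auto simp: N_def)
  qed
  have comp: "compatible_at q (g q)" if q: "q \<in> M" for q
  proof -
    have "compatible_at q (\<lambda>X Y. \<Sum>i\<le>n q. r i q * F i q X Y)"
      by (rule compatible_form_sum[OF compatible_form_mult[OF pt(2)[OF q]]])
    then show ?thesis unfolding g_def .
  qed
  have pos: "g q (b 1) (J1 q (b 2)) > 0" if q: "q \<in> M" and b: "b \<in> ori q" for q b
  proof -
    obtain m where "u m q > 1" using cover[OF q] by blast
    then have un: "u (n q) q > 0" unfolding n_def using LeastI[of "\<lambda>i. u i q > 1" m] by linarith
    \<comment> \<open>The term at \<open>n q\<close> may have weight 0, namely if an earlier
      \<open>u j q\<close> equals 1. At the first index with \<open>u k q > 0\<close> all earlier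
      values are 0, so every factor of \<open>r k q\<close> is \<open>flat_exp 0 1 > 0\<close>; and
      \<open>k \<le> n q\<close>, so the term occurs in the sum.\<close>
    define k where "k = (LEAST i. u i q > 0)"
    have k: "u k q > 0" "k \<le> n q"
      unfolding k_def using un by (auto intro: LeastI Least_le)
    have "u j q = 0" if "j < k" for j
      using not_less_Least[of j "\<lambda>i. u i q > 0"] that pt(1)[OF q, of j] unfolding k_def by linarith
    then have "r k q > 0" unfolding r_def by (intro prod_pos) (auto simp: flat_exp_pos_iff)
    then have "r k q * F k q (b 1) (J1 q (b 2)) > 0" using pt(4)[OF q b k(1)] by simp
    then show ?thesis
      unfolding g_def using k(2) r_nonneg pt(3)[OF q b]
      by (intro sum_pos2[of _ k]) auto
  qed
  have "X = 0" if p: "p \<in> M" and X: "X \<in> T p" "\<And>Y. Y \<in> T p \<Longrightarrow> g p X Y = 0" for p X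
  proof -
    obtain b where b: "b \<in> ori p" using frames[OF p] by blast
    have "b \<in> ordered_bases (V p)" by (rule orientation_mem_ordered_bases[OF ori[OF p] b])
    moreover have "g p (b 1) (J1 p (b 2)) \<noteq> 0" using pos[OF p b] by simp
    ultimately show ?thesis
      using para_hypercomplex_space.compatible_form_nondegenerate[OF para_hypercomplex_tangent_space[OF p] comp[OF p]]
        X unfolding V_eq by blast
  qed
  then have "pseudo_riemannian_metric A g"
    unfolding pseudo_riemannian_metric_def smooth_form_on_carrier_iff[symmetric]
    using smooth_g comp[unfolded compatible_form_def] by blast
  moreover have "compatible_metric A J1 J2 J3 g"
    unfolding compatible_metric_def
  proof (intro ballI)
    fix p X Y assume p: "p \<in> M" and XY: "X \<in> T p" "Y \<in> T p"
    note J2T = endo_mem[OF smooth_J(2) p]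
    have c: "g p (J1 p X) (J1 p Y) = g p X Y \<and> g p (J2 p X) (J2 p Y) = - g p X Y"
      if "X \<in> T p" "Y \<in> T p" for X Y
      using comp[OF p] that unfolding compatible_form_def by blast
    \<comment> \<open>As \<open>J3 = J1 J2\<close>, its sign is the product of those of
      \<open>J1\<close> and \<open>J2\<close>.\<close>
    show "g p (J1 p X) (J1 p Y) = g p X Y \<and> - g p (J2 p X) (J2 p Y) = g p X Y \<and>
        - g p (J3 p X) (J3 p Y) = g p X Y"
      unfolding J_relations(4)[OF p XY(1)] J_relations(4)[OF p XY(2)]
      using c[OF XY] c[OF J2T[OF XY(1)] J2T[OF XY(2)]] by linarith
  qed
  ultimately show thesis by (rule that)
qed

end

theorem proposition8:
  fixes A :: "('a::{t2_space,second_countable_topology}, real ^ 4) chart set"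
    and J1 J2 J3 :: "('a, real ^ 4) endo_field"
    and s :: real
  assumes "smooth_atlas A"
    and "almost_para_hypercomplex A J1 J2 J3"
    and "s = 1 \<or> s = -1"
  shows "(\<exists>g. pseudo_riemannian_metric A g \<and> compatible_metric A J1 J2 J3 g) \<longleftrightarrow>
         orientable_subbundle TYPE(2) A (eigenbundle A J2 s)"
proof -
  interpret para_hypercomplex_manifold A J1 J2 J3 s
    using assms by unfold_locales
  show ?thesis
    using orientable_if_metric metric_if_orientable by blast
qed

end
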